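(* For any $\rho\ge 1$, if there is a $\rho$-competitive online algorithm for supermodular paging, then there is a $\rho$-competitive online algorithm for online set cover whose running time is the same up to polynomial factors.
   Context: Supermodular paging: a finite set $\mathcal{P}$ of pages with eviction costs $c(p)\ge 0$; a monotone supermodular feasibility function $f:2^{\mathcal{P}}\to\mathbb{N}$ (monotone: $S'\subseteq S\Rightarrow f(S')\le f(S)$; supermodular: $f(S)+f(S')\le f(S\cup S')+f(S\cap S')$); a cache threshold $k$ with $f(\{p\})\le k$ for all $p$. The cache is initially empty; requests $p_t\in\mathcal{P}$ arrive online; at time $t$, if $p_t$ is not in the cache it is fetched, and the algorithm may evict pages (other than $p_t$) so that the set $S_t$ of pages in cache afterwards satisfies $f(S_t)\le k$; cost is the total eviction cost. Online set cover: a ground set $X$ and a family $\mathcal{S}$ of subsets of $X$ with costs $c(S)$; elements of $X$ are requested online; when a requested element is not covered by a previously chosen set, the algorithm must (irrevocably) choose a set of $\mathcal{S}$ containing it, paying its cost; the goal is to minimize the total cost of chosen sets. An online algorithm is $\rho$-competitive if on every request sequence its (expected) cost is at most $\rho$ times the optimal offline cost. *)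

theory Defs
  imports
    "HOL-Probability.Probability"
    "HOL-Computational_Algebra.Polynomial"
begin

section \<open>The two problems\<close>

text \<open>
  Pages, elements and sets of the family are named by initial segments of the natural numbers.
  The feasibility function and the costs are only meaningful on these names.
\<close>

record paging =
  num_pages :: nat
  page_cost :: "nat \<Rightarrow> rat"
  feas :: "nat set \<Rightarrow> nat"
  threshold :: nat

definition pages :: "paging \<Rightarrow> nat set" where
  "pages J = {..<num_pages J}"

definition supermodular_on :: "'a set \<Rightarrow> ('a set \<Rightarrow> nat) \<Rightarrow> bool" where
  "supermodular_on P f \<longleftrightarrow>
     (\<forall>S S'. S \<subseteq> P \<longrightarrow> S' \<subseteq> P \<longrightarrow> f S + f S' \<le> f (S \<union> S') + f (S \<inter> S'))"

definition valid_paging :: "paging \<Rightarrow> bool" where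
  "valid_paging J \<longleftrightarrow>
     (\<forall>p\<in>pages J. 0 \<le> page_cost J p) \<and>
     mono_on (Pow (pages J)) (feas J) \<and>
     supermodular_on (pages J) (feas J) \<and>
     (\<forall>p\<in>pages J. feas J {p} \<le> threshold J)"

text \<open>
  \<open>schedule J S ps Es\<close>: starting with cache contents \<open>S\<close>, the requests \<open>ps\<close> can be served by
  evicting the sets \<open>Es\<close>, one (possibly empty) set per request.
\<close>

fun schedule :: "paging \<Rightarrow> nat set \<Rightarrow> nat list \<Rightarrow> nat set list \<Rightarrow> bool" where
  "schedule J S [] [] = True"
| "schedule J S (p # ps) (E # Es) =
     (E \<subseteq> S - {p} \<and> feas J (insert p S - E) \<le> threshold J \<and>
      schedule J (insert p S - E) ps Es)"
| "schedule J S _ _ = False"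

definition eviction_cost :: "paging \<Rightarrow> nat set list \<Rightarrow> rat" where
  "eviction_cost J Es = (\<Sum>E\<leftarrow>Es. \<Sum>p\<in>E. page_cost J p)"

definition paging_opt :: "paging \<Rightarrow> nat list \<Rightarrow> ennreal" where
  "paging_opt J ps =
     (INF Es\<in>{Es. schedule J {} ps Es}. ennreal (real_of_rat (eviction_cost J Es)))"

record setcover =
  num_elems :: nat
  num_sets :: nat
  set_of :: "nat \<Rightarrow> nat set"
  set_cost :: "nat \<Rightarrow> rat"

definition valid_setcover :: "setcover \<Rightarrow> bool" where
  "valid_setcover I \<longleftrightarrow>
     (\<forall>j<num_sets I. set_of I j \<subseteq> {..<num_elems I} \<and> 0 \<le> set_cost I j)"

definition covered :: "setcover \<Rightarrow> nat set \<Rightarrow> nat set" where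
  "covered I C = (\<Union>j\<in>C. set_of I j)"

text \<open>
  The answer \<open>j\<close> to a request is the set chosen for it; it is disregarded if the requested
  element is already covered by the previously chosen sets \<open>C\<close>.
\<close>

fun choices_ok :: "setcover \<Rightarrow> nat set \<Rightarrow> nat list \<Rightarrow> nat list \<Rightarrow> bool" where
  "choices_ok I C [] [] = True"
| "choices_ok I C (x # xs) (j # js) =
     (if x \<in> covered I C then choices_ok I C xs js
      else j < num_sets I \<and> x \<in> set_of I j \<and> choices_ok I (insert j C) xs js)"
| "choices_ok I C _ _ = False"

fun chosen :: "setcover \<Rightarrow> nat set \<Rightarrow> nat list \<Rightarrow> nat list \<Rightarrow> nat set" where
  "chosen I C (x # xs) (j # js) =
     (if x \<in> covered I C then chosen I C xs js else chosen I (insert j C) xs js)"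
| "chosen I C _ _ = C"

definition cover_cost :: "setcover \<Rightarrow> nat set \<Rightarrow> rat" where
  "cover_cost I C = (\<Sum>j\<in>C. set_cost I j)"

definition setcover_opt :: "setcover \<Rightarrow> nat list \<Rightarrow> ennreal" where
  "setcover_opt I xs =
     (INF C\<in>{C. C \<subseteq> {..<num_sets I} \<and> set xs \<subseteq> covered I C}.
        ennreal (real_of_rat (cover_cost I C)))"


section \<open>Programs and their running time\<close>

text \<open>
  Algorithms are programs of a WHILE language over binary trees (following N. D. Jones,
  \<^emph>\<open>Computability and Complexity from a Programming Perspective\<close>), extended by fair coin tosses
  and by queries to an oracle. Every evaluated operator and every executed command costs one unit,
  trees being handled by reference; this measure is polynomially related to Turing machine time.
  Since references make it possible to build trees of exponential size, trees that are passed to or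
  received from the oracle, or are output, are charged with their full size.
\<close>

datatype val = Atom | Cell val val

fun vhd :: "val \<Rightarrow> val" where
  "vhd Atom = Atom"
| "vhd (Cell a b) = a"

fun vtl :: "val \<Rightarrow> val" where
  "vtl Atom = Atom"
| "vtl (Cell a b) = b"

fun cells :: "val \<Rightarrow> nat" where
  "cells Atom = 0"
| "cells (Cell a b) = 1 + cells a + cells b"

datatype expr = EAtom | EVar nat | EHd expr | ETl expr | ECell expr expr

type_synonym store = "nat \<Rightarrow> val"

fun eval :: "expr \<Rightarrow> store \<Rightarrow> val" where
  "eval EAtom s = Atom"
| "eval (EVar x) s = s x"
| "eval (EHd e) s = vhd (eval e s)"
| "eval (ETl e) s = vtl (eval e s)"
| "eval (ECell d e) s = Cell (eval d s) (eval e s)"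

fun ops :: "expr \<Rightarrow> nat" where
  "ops EAtom = 1"
| "ops (EVar x) = 1"
| "ops (EHd e) = 1 + ops e"
| "ops (ETl e) = 1 + ops e"
| "ops (ECell d e) = 1 + ops d + ops e"

datatype com =
    Skip
  | Assign nat expr
  | Seq com com
  | Cond expr com com
  | While expr com
  | Toss nat
  | Query nat expr

fun toss_free :: "com \<Rightarrow> bool" where
  "toss_free (Seq c d) = (toss_free c \<and> toss_free d)"
| "toss_free (Cond e c d) = (toss_free c \<and> toss_free d)"
| "toss_free (While e c) = toss_free c"
| "toss_free (Toss x) = False"
| "toss_free _ = True"

fun query_free :: "com \<Rightarrow> bool" where
  "query_free (Seq c d) = (query_free c \<and> query_free d)"
| "query_free (Cond e c d) = (query_free c \<and> query_free d)"
| "query_free (While e c) = query_free c"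
| "query_free (Query x e) = False"
| "query_free _ = True"

definition enc_bool :: "bool \<Rightarrow> val" where
  "enc_bool b = (if b then Cell Atom Atom else Atom)"

text \<open>
  \<open>big_step orc c s w s' w' t\<close>: with oracle \<open>orc\<close>, the command \<open>c\<close> started in store \<open>s\<close> with the
  infinite sequence \<open>w\<close> of coin tosses ahead terminates in store \<open>s'\<close> after \<open>t\<close> units of time,
  with \<open>w'\<close> the tosses not yet used.
\<close>

inductive big_step ::
  "(val \<Rightarrow> val) \<Rightarrow> com \<Rightarrow> store \<Rightarrow> bool stream \<Rightarrow> store \<Rightarrow> bool stream \<Rightarrow> nat \<Rightarrow> bool"
  for orc where
  Skip: "big_step orc Skip s w s w 1"
| Assign: "big_step orc (Assign x e) s w (s(x := eval e s)) w (1 + ops e)"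
| Seq: "big_step orc c s w s' w' t \<Longrightarrow> big_step orc d s' w' s'' w'' u \<Longrightarrow>
    big_step orc (Seq c d) s w s'' w'' (1 + t + u)"
| CondT: "eval e s \<noteq> Atom \<Longrightarrow> big_step orc c s w s' w' t \<Longrightarrow>
    big_step orc (Cond e c d) s w s' w' (1 + ops e + t)"
| CondF: "eval e s = Atom \<Longrightarrow> big_step orc d s w s' w' t \<Longrightarrow>
    big_step orc (Cond e c d) s w s' w' (1 + ops e + t)"
| WhileF: "eval e s = Atom \<Longrightarrow> big_step orc (While e c) s w s w (1 + ops e)"
| WhileT: "eval e s \<noteq> Atom \<Longrightarrow> big_step orc c s w s' w' t \<Longrightarrow>
    big_step orc (While e c) s' w' s'' w'' u \<Longrightarrow>
    big_step orc (While e c) s w s'' w'' (1 + ops e + t + u)"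
| Toss: "big_step orc (Toss x) s w (s(x := enc_bool (shd w))) (stl w) 1"
| Query: "a = eval e s \<Longrightarrow>
    big_step orc (Query x e) s w (s(x := orc a)) w (1 + ops e + cells a + cells (orc a))"

inductive_cases SkipE: "big_step orc Skip s w s' w' t"
inductive_cases AssignE: "big_step orc (Assign x e) s w s' w' t"
inductive_cases SeqE: "big_step orc (Seq c d) s w s' w' t"
inductive_cases CondE: "big_step orc (Cond e c d) s w s' w' t"
inductive_cases WhileE: "big_step orc (While e c) s w s' w' t"
inductive_cases TossE: "big_step orc (Toss x) s w s' w' t"
inductive_cases QueryE: "big_step orc (Query x e) s w s' w' t"

lemma big_step_deterministic:
  "big_step orc c s w s1 w1 t1 \<Longrightarrow> big_step orc c s w s2 w2 t2 \<Longrightarrow>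
     s1 = s2 \<and> w1 = w2 \<and> t1 = t2"
proof (induction arbitrary: s2 w2 t2 rule: big_step.induct)
  case (Skip s w) from Skip.prems show ?case by (rule SkipE) simp
next
  case (Assign x e s w) from Assign.prems show ?case by (rule AssignE) simp
next
  case (Seq c s w s' w' t d s'' w'' u)
  from Seq.prems obtain sa wa ta ua where
    "big_step orc c s w sa wa ta" "big_step orc d sa wa s2 w2 ua" "t2 = 1 + ta + ua"
    by (rule SeqE) simp
  with Seq.IH(1) Seq.IH(2) show ?case by metis
next
  case (CondT e s c w s' w' t d)
  from CondT.prems obtain ta where
    "big_step orc c s w s2 w2 ta" "t2 = 1 + ops e + ta"
    by (rule CondE) (use CondT.hyps(1) in simp_all)
  with CondT.IH show ?case by metis
next
  case (CondF e s d w s' w' t c)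
  from CondF.prems obtain ta where
    "big_step orc d s w s2 w2 ta" "t2 = 1 + ops e + ta"
    by (rule CondE) (use CondF.hyps(1) in simp_all)
  with CondF.IH show ?case by metis
next
  case (WhileF e s c w)
  from WhileF.prems show ?case by (rule WhileE) (use WhileF.hyps in simp_all)
next
  case (WhileT e s c w s' w' t s'' w'' u)
  from WhileT.prems obtain sa wa ta ua where
    "big_step orc c s w sa wa ta" "big_step orc (While e c) sa wa s2 w2 ua"
    "t2 = 1 + ops e + ta + ua"
    by (rule WhileE) (use WhileT.hyps(1) in simp_all)
  with WhileT.IH(1) WhileT.IH(2) show ?case by metis
next
  case (Toss x s w) from Toss.prems show ?case by (rule TossE) simp
next
  case (Query a e s x w) from Query.prems show ?case by (rule QueryE) (use Query.hyps in simp_all)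
qed

definition exec ::
  "(val \<Rightarrow> val) \<Rightarrow> com \<Rightarrow> store \<Rightarrow> bool stream \<Rightarrow> (store \<times> bool stream \<times> nat) option" where
  "exec orc c s w =
     (if \<exists>s' w' t. big_step orc c s w s' w' t
      then Some (THE (s', w', t). big_step orc c s w s' w' t) else None)"


section \<open>Encoding of the inputs\<close>

fun enc_list :: "val list \<Rightarrow> val" where
  "enc_list [] = Atom"
| "enc_list (v # vs) = Cell v (enc_list vs)"

text \<open>
  Names of pages, elements and sets are written in unary, all other numbers in binary (least
  significant bit first). Unary names are harmless as they are bounded by the size of the input.
\<close>

fun enc_name :: "nat \<Rightarrow> val" where
  "enc_name 0 = Atom"
| "enc_name (Suc n) = Cell Atom (enc_name n)"

fun bits :: "nat \<Rightarrow> bool list" where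
  "bits n = (if n = 0 then [] else odd n # bits (n div 2))"

declare bits.simps [simp del]

definition enc_nat :: "nat \<Rightarrow> val" where
  "enc_nat n = enc_list (map enc_bool (bits n))"

definition num_den :: "rat \<Rightarrow> nat \<times> nat" where
  "num_den q = map_prod nat nat (quotient_of q)"

definition enc_rat :: "rat \<Rightarrow> val" where
  "enc_rat q = Cell (enc_nat (fst (num_den q))) (enc_nat (snd (num_den q)))"

definition rat_length :: "rat \<Rightarrow> nat" where
  "rat_length q = length (bits (fst (num_den q))) + length (bits (snd (num_den q)))"

text \<open>Decoding is total: every tree is read as a name and as a list of names.\<close>

fun dec_name :: "val \<Rightarrow> nat" where
  "dec_name Atom = 0"
| "dec_name (Cell a b) = Suc (dec_name b)"

fun dec_names :: "val \<Rightarrow> nat set" where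
  "dec_names Atom = {}"
| "dec_names (Cell a b) = insert (dec_name a) (dec_names b)"

definition enc_paging :: "paging \<Rightarrow> val" where
  "enc_paging J =
     Cell (enc_nat (threshold J)) (enc_list (map (\<lambda>p. enc_rat (page_cost J p)) [0..<num_pages J]))"

text \<open>The feasibility function is given by a value oracle, queried with lists of pages.\<close>

definition feas_oracle :: "paging \<Rightarrow> val \<Rightarrow> val" where
  "feas_oracle J v = enc_nat (feas J (dec_names v \<inter> pages J))"

definition enc_setcover :: "setcover \<Rightarrow> val" where
  "enc_setcover I =
     Cell (enc_name (num_elems I))
       (enc_list (map (\<lambda>j. Cell (enc_rat (set_cost I j))
            (enc_list (map enc_name (sorted_list_of_set (set_of I j))))) [0..<num_sets I]))"

text \<open>
  Input sizes: the number of objects and of requests plus the lengths of the numbers involved. For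
  paging, the latter include the largest value of the feasibility function.
\<close>

definition paging_size :: "paging \<Rightarrow> nat list \<Rightarrow> nat" where
  "paging_size J ps =
     num_pages J + (\<Sum>p<num_pages J. rat_length (page_cost J p)) +
     length (bits (threshold J)) + length (bits (feas J (pages J))) + length ps"

definition setcover_size :: "setcover \<Rightarrow> nat list \<Rightarrow> nat" where
  "setcover_size I xs =
     num_elems I + (\<Sum>j<num_sets I. 1 + card (set_of I j) + rat_length (set_cost I j)) + length xs"


section \<open>Online algorithms\<close>

text \<open>
  An online algorithm first runs \<open>init\<close> with the instance in variable 0 and then, for every request,
  runs \<open>step\<close> with the request in variable 1 and leaves its answer in variable 2. The store is kept
  between the requests.
\<close>

record online_alg =
  init :: com
  step :: com

fun serve ::
  "(val \<Rightarrow> val) \<Rightarrow> com \<Rightarrow> store \<Rightarrow> bool stream \<Rightarrow> nat list \<Rightarrow> (val list \<times> nat) option" where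
  "serve orc c s w [] = Some ([], 0)"
| "serve orc c s w (r # rs) =
     (case exec orc c (s(1 := enc_name r)) w of
        None \<Rightarrow> None
      | Some (s', w', t) \<Rightarrow>
          map_option (\<lambda>(vs, u). (s' 2 # vs, t + cells (s' 2) + u)) (serve orc c s' w' rs))"

definition run ::
  "(val \<Rightarrow> val) \<Rightarrow> online_alg \<Rightarrow> val \<Rightarrow> nat list \<Rightarrow> bool stream \<Rightarrow> (val list \<times> nat) option" where
  "run orc A v rs w =
     (case exec orc (init A) ((\<lambda>_. Atom)(0 := v)) w of
        None \<Rightarrow> None
      | Some (s, w', t) \<Rightarrow> map_option (\<lambda>(vs, u). (vs, t + u)) (serve orc (step A) s w' rs))"

definition run_time :: "(val list \<times> nat) option \<Rightarrow> enat" where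
  "run_time r = (case r of None \<Rightarrow> \<infinity> | Some (vs, t) \<Rightarrow> enat t)"

definition coins :: "bool stream measure" where
  "coins = stream_space (measure_pmf (bernoulli_pmf (1 / 2)))"

definition deterministic :: "online_alg \<Rightarrow> bool" where
  "deterministic A \<longleftrightarrow> toss_free (init A) \<and> toss_free (step A)"

definition oracle_free :: "online_alg \<Rightarrow> bool" where
  "oracle_free A \<longleftrightarrow> query_free (init A) \<and> query_free (step A)"

definition paging_run ::
  "online_alg \<Rightarrow> paging \<Rightarrow> nat list \<Rightarrow> bool stream \<Rightarrow> (val list \<times> nat) option" where
  "paging_run A J ps w = run (feas_oracle J) A (enc_paging J) ps w"

definition paging_input :: "paging \<Rightarrow> nat list \<Rightarrow> bool" where
  "paging_input J ps \<longleftrightarrow> valid_paging J \<and> set ps \<subseteq> pages J"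

text \<open>
  Competitiveness is strict (no additive constant). The ratio may depend on the number of pages;
  a constant ratio is the special case of a constant function.
\<close>

definition competitive_paging :: "(nat \<Rightarrow> real) \<Rightarrow> online_alg \<Rightarrow> bool" where
  "competitive_paging \<rho> A \<longleftrightarrow>
     (\<forall>J ps. paging_input J ps \<longrightarrow>
        (AE w in coins. \<exists>vs t. paging_run A J ps w = Some (vs, t) \<and>
             schedule J {} ps (map dec_names vs)) \<and>
        (\<integral>\<^sup>+ w. (case paging_run A J ps w of None \<Rightarrow> \<infinity>
             | Some (vs, t) \<Rightarrow> ennreal (real_of_rat (eviction_cost J (map dec_names vs)))) \<partial>coins)
          \<le> ennreal (\<rho> (num_pages J)) * paging_opt J ps)"

definition setcover_run ::
  "online_alg \<Rightarrow> setcover \<Rightarrow> nat list \<Rightarrow> bool stream \<Rightarrow> (val list \<times> nat) option" where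
  "setcover_run B I xs w = run (\<lambda>_. Atom) B (enc_setcover I) xs w"

definition setcover_input :: "setcover \<Rightarrow> nat list \<Rightarrow> bool" where
  "setcover_input I xs \<longleftrightarrow> valid_setcover I \<and> set xs \<subseteq> covered I {..<num_sets I}"

definition competitive_setcover :: "(nat \<Rightarrow> nat \<Rightarrow> real) \<Rightarrow> online_alg \<Rightarrow> bool" where
  "competitive_setcover \<rho> B \<longleftrightarrow>
     (\<forall>I xs. setcover_input I xs \<longrightarrow>
        (AE w in coins. \<exists>vs t. setcover_run B I xs w = Some (vs, t) \<and>
             choices_ok I {} xs (map dec_name vs)) \<and>
        (\<integral>\<^sup>+ w. (case setcover_run B I xs w of None \<Rightarrow> \<infinity>
             | Some (vs, t) \<Rightarrow>
                 ennreal (real_of_rat (cover_cost I (chosen I {} xs (map dec_name vs))))) \<partial>coins)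
          \<le> ennreal (\<rho> (num_elems I) (num_sets I)) * setcover_opt I xs)"

text \<open>
  Total running time on inputs of size at most \<open>n\<close>, in the worst case over the inputs; with respect
  to the coin tosses either in the worst case or in expectation.
\<close>

definition paging_worst_time :: "online_alg \<Rightarrow> nat \<Rightarrow> enat" where
  "paging_worst_time A n =
     (SUP (J, ps)\<in>{(J, ps). paging_input J ps \<and> paging_size J ps \<le> n}.
        SUP w. run_time (paging_run A J ps w))"

definition paging_expected_time :: "online_alg \<Rightarrow> nat \<Rightarrow> ennreal" where
  "paging_expected_time A n =
     (SUP (J, ps)\<in>{(J, ps). paging_input J ps \<and> paging_size J ps \<le> n}.
        \<integral>\<^sup>+ w. ennreal_of_enat (run_time (paging_run A J ps w)) \<partial>coins)"

definition setcover_worst_time :: "online_alg \<Rightarrow> nat \<Rightarrow> enat" where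
  "setcover_worst_time B n =
     (SUP (I, xs)\<in>{(I, xs). setcover_input I xs \<and> setcover_size I xs \<le> n}.
        SUP w. run_time (setcover_run B I xs w))"

definition setcover_expected_time :: "online_alg \<Rightarrow> nat \<Rightarrow> ennreal" where
  "setcover_expected_time B n =
     (SUP (I, xs)\<in>{(I, xs). setcover_input I xs \<and> setcover_size I xs \<le> n}.
        \<integral>\<^sup>+ w. ennreal_of_enat (run_time (setcover_run B I xs w)) \<partial>coins)"

end

theory Submission
  imports Defs
begin

text \<open>
  Take the elements (at cost 0) and the sets (at their costs) as pages. Call a collection of pages
  conflicting if it contains an element together with all the sets containing that element, and let
  \<open>f T\<close> be \<open>2 ^ card T\<close> if \<open>T\<close> is conflicting and 0 otherwise. First request all the sets,
  then the elements of the set cover instance. Whenever an element is requested, a set containing it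
  must have been evicted before or must be evicted now, so the evicted sets cover the requested
  elements; since no set is requested again, choosing evicted sets costs at most as much as the
  evictions. Conversely, evicting an optimal cover at the first element request serves everything.

  The set cover algorithm runs the paging algorithm on this instance, with the same coin tosses,
  replaces every oracle query by code that evaluates \<open>f\<close>, and remembers the evicted pages.
\<close>

text \<open>An indicator of conflicts would not be supermodular: two disjoint conflicting
  collections would give 1 + 1 > 1 + 0. With the weight \<open>2 ^ card T\<close> every further page
  at least doubles the value of a conflicting collection, and this growth pays for the second
  summand. The values are exponential, but sizes and oracle answers are measured in binary, so they
  have only linearly many bits.

  Costs are compared for each sequence of coin tosses separately. Hence expectations need nothing
  beyond monotonicity of the integral, and a deterministic paging algorithm yields a deterministic
  set cover algorithm.

  The delicate point is time. Nothing is known about the paging program, so its input must be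
  rebuilt literally and its queries must be answered exactly, including queries with repeated or
  meaningless names. As queries and answers are charged with their size, evaluating \<open>f\<close>
  costs only a factor polynomial in the instance per unit of simulated time.\<close>

section \<open>Timed weakest preconditions\<close>

text \<open>The final store and the time are chosen before the tosses, which are left unconsumed:
  code specified in this way can be inserted into the simulated program without shifting the tosses
  that it sees. Termination is part of the claim, and the oracle is the constant one of
  \<open>setcover_run\<close>.\<close>

definition wp :: "com \<Rightarrow> store \<Rightarrow> (store \<Rightarrow> nat \<Rightarrow> bool) \<Rightarrow> bool" where
  "wp c s Q \<longleftrightarrow> (\<exists>s' t. (\<forall>w. big_step (\<lambda>_. Atom) c s w s' w t) \<and> Q s' t)"

fun mods :: "com \<Rightarrow> nat set" where
  "mods Skip = {}"
| "mods (Assign x e) = {x}"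
| "mods (Seq c d) = mods c \<union> mods d"
| "mods (Cond e c d) = mods c \<union> mods d"
| "mods (While e c) = mods c"
| "mods (Toss x) = {x}"
| "mods (Query x e) = {x}"

lemma big_step_frame: "big_step orc c s w s' w' t \<Longrightarrow> y \<notin> mods c \<Longrightarrow> s' y = s y"
  by (induction rule: big_step.induct) auto

lemma big_step_time_pos: "big_step orc c s w s' w' t \<Longrightarrow> 1 \<le> t"
  by (induction rule: big_step.induct) auto

text \<open>With the frame property built into this rule, specifications only speak of registers
  that a program changes.\<close>

lemma wp_conseq:
  assumes "wp c s Q"
    and "\<And>s' t. Q s' t \<Longrightarrow> (\<And>y. y \<notin> mods c \<Longrightarrow> s' y = s y) \<Longrightarrow> Q' s' t"
  shows "wp c s Q'"
  using assms big_step_frame unfolding wp_def by metis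

lemma wp_Skip: "Q s 1 \<Longrightarrow> wp Skip s Q"
  unfolding wp_def by (metis big_step.Skip)

lemma wp_Assign: "Q (s(x := eval e s)) (1 + ops e) \<Longrightarrow> wp (Assign x e) s Q"
  unfolding wp_def by (metis big_step.Assign)

lemma wp_Seq: "wp c s (\<lambda>s1 t1. wp d s1 (\<lambda>s2 t2. Q s2 (1 + t1 + t2))) \<Longrightarrow> wp (Seq c d) s Q"
  unfolding wp_def by (metis big_step.Seq)

lemma wp_Cond:
  assumes "eval e s \<noteq> Atom \<Longrightarrow> wp c s (\<lambda>s' t. Q s' (1 + ops e + t))"
    and "eval e s = Atom \<Longrightarrow> wp d s (\<lambda>s' t. Q s' (1 + ops e + t))"
  shows "wp (Cond e c d) s Q"
  using assms unfolding wp_def by (metis big_step.CondT big_step.CondF)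

lemmas wp_intros = wp_Skip wp_Assign wp_Seq wp_Cond

section \<open>Names, lists and truth values as right spines\<close>

lemma eq_Atom_iff: "v = Atom \<longleftrightarrow> dec_name v = 0"
  by (cases v) auto

lemma dec_name_vtl [simp]: "dec_name (vtl v) = dec_name v - 1"
  by (cases v) auto

text \<open>\<open>dec_name\<close> measures the right spine, so it is the value of a unary name and
  equally the length of a list. It counts loop rounds, whereas queries and answers are charged by
  \<open>cells\<close>; this inequality pays for the former with the latter.\<close>

lemma dec_name_le_cells: "dec_name v \<le> cells v"
  by (induction v) auto

lemma dec_name_enc_name [simp]: "dec_name (enc_name k) = k"
  and cells_enc_name [simp]: "cells (enc_name k) = k"
  by (induction k) auto

lemma dec_name_enc_list [simp]: "dec_name (enc_list vs) = length vs"
  by (induction vs) auto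

lemma dec_names_enc_list [simp]: "dec_names (enc_list vs) = dec_name ` set vs"
  by (induction vs) auto

lemma finite_dec_names [simp]: "finite (dec_names v)"
  by (induction v) auto

text \<open>One loop serves for lists and for unary counters, and it consumes its register. For a
  counter, the tail of the register is the 0-based index, running downwards.\<close>

definition for_each :: "nat \<Rightarrow> com \<Rightarrow> com" where
  "for_each l c = While (EVar l) (Seq c (Assign l (ETl (EVar l))))"

lemma mods_for_each [simp]: "mods (for_each l c) = insert l (mods c)"
  by (auto simp: for_each_def)

lemma toss_free_for_each [simp]: "toss_free (for_each l c) = toss_free c"
  and query_free_for_each [simp]: "query_free (for_each l c) = query_free c"
  by (simp_all add: for_each_def)

lemma for_each_Atom:
  "s l = Atom \<Longrightarrow> big_step orc (for_each l c) s w s w 2"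
  using WhileF[of "EVar l" s] by (simp add: for_each_def numeral_2_eq_2)

lemma for_each_Cell:
  assumes "s l = Cell a v" and "big_step orc c s w s1 w1 t" and "s1 l = s l"
    and "big_step orc (for_each l c) (s1(l := v)) w1 s2 w2 u"
  shows "big_step orc (for_each l c) s w s2 w2 (6 + t + u)"
proof -
  have "big_step orc (Assign l (ETl (EVar l))) s1 w1 (s1(l := v)) w1 3"
    using Assign[of orc l "ETl (EVar l)" s1 w1] assms(1,3) by (simp add: numeral_3_eq_3)
  from WhileT[OF _ Seq[OF assms(2) this] assms(4)[unfolded for_each_def]] assms(1)
  show ?thesis by (simp add: for_each_def)
qed

text \<open>The invariant is indexed by the part of the list not yet traversed. The body may use the
  frame relative to the store before the loop, so constant registers stay out of the
  invariant.\<close>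

lemma wp_for_each:
  assumes l: "l \<notin> mods c"
    and init: "Inv (s l) s"
    and step: "\<And>s' a v. s' l = Cell a v \<Longrightarrow> Inv (Cell a v) s' \<Longrightarrow>
      (\<And>y. y \<noteq> l \<Longrightarrow> y \<notin> mods c \<Longrightarrow> s' y = s y) \<Longrightarrow>
      wp c s' (\<lambda>s'' t. t \<le> b \<and> Inv v (s''(l := v)))"
  shows "wp (for_each l c) s (\<lambda>s' t. t \<le> 2 + (6 + b) * dec_name (s l) \<and> Inv Atom s')"
proof -
  have "wp (for_each l c) s' (\<lambda>s' t. t \<le> 2 + (6 + b) * dec_name v \<and> Inv Atom s')"
    if "s' l = v" "Inv v s'" "\<And>y. y \<noteq> l \<Longrightarrow> y \<notin> mods c \<Longrightarrow> s' y = s y" for v s'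
    using that
  proof (induction v arbitrary: s')
    case Atom
    show ?case
      unfolding wp_def
      by (rule exI[of _ s'], rule exI[of _ 2]) (use Atom for_each_Atom in auto)
  next
    case (Cell a v)
    from step[OF Cell.prems] obtain s1 t where
      s1: "\<And>w. big_step (\<lambda>_. Atom) c s' w s1 w t" and t: "t \<le> b" and inv: "Inv v (s1(l := v))"
      unfolding wp_def by blast
    have frame: "s1 y = s' y" if "y \<notin> mods c" for y
      using big_step_frame[OF s1[of undefined] that] .
    have "wp (for_each l c) (s1(l := v)) (\<lambda>s' t. t \<le> 2 + (6 + b) * dec_name v \<and> Inv Atom s')"
    proof (rule Cell.IH(2)[OF _ inv])
      show "(s1(l := v)) y = s y" if "y \<noteq> l" "y \<notin> mods c" for y
        using that frame Cell.prems(3) by simp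
    qed simp
    then obtain s2 u where
      s2: "\<And>w. big_step (\<lambda>_. Atom) (for_each l c) (s1(l := v)) w s2 w u"
      and u: "u \<le> 2 + (6 + b) * dec_name v" and "Inv Atom s2"
      unfolding wp_def by blast
    have "big_step (\<lambda>_. Atom) (for_each l c) s' w s2 w (6 + t + u)" for w
      using for_each_Cell[OF Cell.prems(1) s1 frame[OF l] s2] .
    moreover have "6 + t + u \<le> 2 + (6 + b) * dec_name (Cell a v)"
      using t u by simp
    ultimately show ?case
      using \<open>Inv Atom s2\<close> unfolding wp_def by blast
  qed
  from this[OF refl init] show ?thesis by simp
qed

text \<open>The same rule with a rising position \<open>j\<close> in place of the remaining list.
  Quantifying over \<open>u\<close> makes the invariant independent of the loop register.\<close>

lemma wp_for_each_enc_list: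
  assumes l: "l \<notin> mods c"
    and sl: "s l = enc_list (map g [0..<m])"
    and init: "Inv 0 s"
    and step: "\<And>s' j. j < m \<Longrightarrow> vhd (s' l) = g j \<Longrightarrow> Inv j s' \<Longrightarrow>
      (\<And>y. y \<noteq> l \<Longrightarrow> y \<notin> mods c \<Longrightarrow> s' y = s y) \<Longrightarrow>
      wp c s' (\<lambda>s'' t. t \<le> b \<and> (\<forall>u. Inv (Suc j) (s''(l := u))))"
  shows "wp (for_each l c) s (\<lambda>s' t. t \<le> 2 + (6 + b) * m \<and> Inv m s')"
proof -
  define J where "J v s' \<longleftrightarrow> (\<exists>j\<le>m. v = enc_list (map g [j..<m]) \<and> Inv j s')" for v s'
  have "wp (for_each l c) s (\<lambda>s' t. t \<le> 2 + (6 + b) * dec_name (s l) \<and> J Atom s')"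
  proof (rule wp_for_each[OF l])
    show "J (s l) s" using sl init by (auto simp: J_def)
  next
    fix s' a v
    assume *: "s' l = Cell a v" "J (Cell a v) s'"
      "\<And>y. y \<noteq> l \<Longrightarrow> y \<notin> mods c \<Longrightarrow> s' y = s y"
    then obtain j where j: "j \<le> m" "Cell a v = enc_list (map g [j..<m])" "Inv j s'"
      by (auto simp: J_def)
    then have "j < m" by (cases "j = m") auto
    with j have a: "a = g j" and v: "v = enc_list (map g [Suc j..<m])"
      by (simp_all add: upt_conv_Cons)
    have "wp c s' (\<lambda>s'' t. t \<le> b \<and> (\<forall>u. Inv (Suc j) (s''(l := u))))"
      using step[OF \<open>j < m\<close> _ j(3) *(3)] *(1) a by simp
    then show "wp c s' (\<lambda>s'' t. t \<le> b \<and> J v (s''(l := v)))"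
      by (rule wp_conseq) (use \<open>j < m\<close> v in \<open>auto simp: J_def intro!: exI[of _ "Suc j"]\<close>)
  qed
  moreover have "j = m" if "j \<le> m" "Atom = enc_list (map g [j..<m])" for j
    using that by (cases "j = m") (auto simp: upt_conv_Cons)
  ultimately show ?thesis
    by (elim wp_conseq) (auto simp: sl J_def)
qed

text \<open>
  The registers of the constructed program; register \<open>x\<close> of the simulated paging algorithm is
  register \<open>x + base\<close>.
\<close>

abbreviation (input) "vInst \<equiv> 0 :: nat"
abbreviation (input) "vReq \<equiv> 1 :: nat"
abbreviation (input) "vAns \<equiv> 2 :: nat"
abbreviation (input) "vPages \<equiv> 3 :: nat"
abbreviation (input) "vEvicted \<equiv> 4 :: nat"
abbreviation (input) "vPage \<equiv> 5 :: nat"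
abbreviation (input) "vCount \<equiv> 6 :: nat"
abbreviation (input) "vSets \<equiv> 7 :: nat"
abbreviation (input) "vElem \<equiv> 8 :: nat"
abbreviation (input) "vList \<equiv> 9 :: nat"
abbreviation (input) "vLeft \<equiv> 10 :: nat"
abbreviation (input) "vRight \<equiv> 11 :: nat"
abbreviation (input) "vFound \<equiv> 12 :: nat"
abbreviation (input) "vKey \<equiv> 13 :: nat"
abbreviation (input) "vFree \<equiv> 14 :: nat"
abbreviation (input) "vConflict \<equiv> 15 :: nat"
abbreviation (input) "vResult \<equiv> 16 :: nat"
abbreviation (input) "vQuery \<equiv> 17 :: nat"
abbreviation (input) "vIndex \<equiv> 18 :: nat"
abbreviation (input) "vTodo \<equiv> 19 :: nat"
abbreviation (input) "vNext \<equiv> 20 :: nat"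
abbreviation (input) "base \<equiv> 32 :: nat"

abbreviation (input) seq :: "com \<Rightarrow> com \<Rightarrow> com" (infixr ";;" 60) where
  "c ;; d \<equiv> Seq c d"

abbreviation (input) "ETrue \<equiv> ECell EAtom EAtom"

section \<open>Membership of a name in a list\<close>

definition member_prog :: "expr \<Rightarrow> expr \<Rightarrow> com" where
  "member_prog x l =
     Assign vKey x ;; Assign vList l ;; Assign vFound EAtom ;;
     for_each vList
       (Assign vLeft (EVar vKey) ;; Assign vRight (ECell EAtom (EHd (EVar vList))) ;;
        for_each vLeft (Assign vRight (ETl (EVar vRight))) ;;
        Cond (EVar vRight) (Cond (ETl (EVar vRight)) Skip (Assign vFound ETrue)) Skip)"

lemma mods_member_prog [simp]:
  "mods (member_prog x l) = {vKey, vList, vFound, vLeft, vRight}"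
  by (auto simp: member_prog_def)

lemma free_member_prog [simp]: "toss_free (member_prog x l)" "query_free (member_prog x l)"
  by (simp_all add: member_prog_def)

fun vars :: "expr \<Rightarrow> nat set" where
  "vars EAtom = {}"
| "vars (EVar x) = {x}"
| "vars (EHd e) = vars e"
| "vars (ETl e) = vars e"
| "vars (ECell d e) = vars d \<union> vars e"

lemma eval_upd [simp]: "y \<notin> vars e \<Longrightarrow> eval e (s(y := u)) = eval e s"
  by (induction e) auto

text \<open>
  \<open>vRight\<close> starts as the successor of a list entry, and \<open>vtl Atom = Atom\<close> truncates the subtraction
  of the key from it. So the two names agree iff exactly one cell is left.
\<close>

lemma wp_subtract:
  "wp (for_each vLeft (Assign vRight (ETl (EVar vRight)))) s
     (\<lambda>s' t. t \<le> 2 + 9 * dec_name (s vLeft) \<and>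
        dec_name (s' vRight) = dec_name (s vRight) - dec_name (s vLeft))"
proof -
  have "wp (for_each vLeft (Assign vRight (ETl (EVar vRight)))) s
     (\<lambda>s' t. t \<le> 2 + (6 + 3) * dec_name (s vLeft) \<and>
        dec_name (s' vRight) - dec_name Atom = dec_name (s vRight) - dec_name (s vLeft))"
    by (rule wp_for_each[where Inv = "\<lambda>v s'. dec_name (s' vRight) - dec_name v =
          dec_name (s vRight) - dec_name (s vLeft)"])
      (auto intro!: wp_intros)
  then show ?thesis by (rule wp_conseq) simp
qed

text \<open>Both arguments are copied because loops consume their registers; the key is copied
  first, so \<open>l\<close> must not read \<open>vKey\<close>. Strict bounds \<open>M\<close> and
  \<open>G\<close> instead of actual lengths let callers use one bound for all their tests.\<close>

lemma wp_member_prog: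
  assumes "vKey \<notin> vars l"
    and ops: "ops x + ops l \<le> 10"
    and M: "dec_name (eval x s) < M" and G: "dec_name (eval l s) < G"
  shows "wp (member_prog x l) s
     (\<lambda>s' t. t \<le> 60 * (M * G) \<and>
        (s' vFound \<noteq> Atom \<longleftrightarrow> dec_name (eval x s) \<in> dec_names (eval l s)))"
proof -
  define k where "k = dec_name (eval x s)"
  define L where "L = eval l s"
  define body where "body = Assign vLeft (EVar vKey) ;;
     Assign vRight (ECell EAtom (EHd (EVar vList))) ;;
     for_each vLeft (Assign vRight (ETl (EVar vRight))) ;;
     Cond (EVar vRight) (Cond (ETl (EVar vRight)) Skip (Assign vFound ETrue)) Skip"
  have body: "wp body s'
     (\<lambda>s'' t. t \<le> 23 + 9 * dec_name (s' vKey) \<and>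
        (s'' vFound \<noteq> Atom \<longleftrightarrow>
           s' vFound \<noteq> Atom \<or> dec_name (s' vKey) = dec_name (vhd (s' vList))))" for s'
    unfolding body_def
    by (intro wp_Seq wp_Assign, rule wp_conseq[OF wp_subtract])
      (auto intro!: wp_intros simp: eq_Atom_iff)
  have loop: "wp (for_each vList body) s'
     (\<lambda>s'' t. t \<le> 2 + (6 + (23 + 9 * k)) * dec_name L \<and>
        (s'' vFound \<noteq> Atom \<or> k \<in> dec_names Atom \<longleftrightarrow> k \<in> dec_names L))"
    if s': "s' vKey = eval x s" "s' vList = L" "s' vFound = Atom" for s'
  proof -
    have "wp (for_each vList body) s'
      (\<lambda>s'' t. t \<le> 2 + (6 + (23 + 9 * k)) * dec_name (s' vList) \<and>
        (s'' vFound \<noteq> Atom \<or> k \<in> dec_names Atom \<longleftrightarrow> k \<in> dec_names L))"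
    proof (rule wp_for_each[where
          Inv = "\<lambda>v s''. s'' vFound \<noteq> Atom \<or> k \<in> dec_names v \<longleftrightarrow> k \<in> dec_names L"])
      show "s' vFound \<noteq> Atom \<or> k \<in> dec_names (s' vList) \<longleftrightarrow> k \<in> dec_names L"
        using s' by simp
    next
      fix s'' a v
      assume *: "s'' vList = Cell a v"
        "s'' vFound \<noteq> Atom \<or> k \<in> dec_names (Cell a v) \<longleftrightarrow> k \<in> dec_names L"
        "\<And>y. y \<noteq> vList \<Longrightarrow> y \<notin> mods body \<Longrightarrow> s'' y = s' y"
      have "s'' vKey = eval x s" using *(3)[of vKey] s'(1) by (simp add: body_def)
      then show "wp body s'' (\<lambda>s3 t. t \<le> 23 + 9 * k \<and>
          ((s3(vList := v)) vFound \<noteq> Atom \<or> k \<in> dec_names v \<longleftrightarrow> k \<in> dec_names L))"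
        by (intro wp_conseq[OF body]) (use *(1,2) in \<open>auto simp: k_def\<close>)
    qed (simp add: body_def)
    then show ?thesis by (simp add: s')
  qed
  \<comment> \<open>Since \<open>k < M\<close>, a round costs at most
    \<open>29 + 9 * k \<le> 38 * M\<close>. The straight-line code costs at most 21, which
    \<open>1 \<le> M * G\<close> absorbs: 38 + 21 < 60.\<close>
  have time: "2 + 4 + ops x + ops l + 2 + 3 + (29 + 9 * k) * dec_name L \<le> 60 * (M * G)"
  proof -
    have "(29 + 9 * k) * dec_name L \<le> (38 * M) * dec_name L"
      by (rule mult_right_mono) (use M in \<open>auto simp: k_def\<close>)
    moreover have "38 * (M * Suc (dec_name L)) \<le> 38 * (M * G)"
      by (intro mult_le_mono2) (use G in \<open>simp add: L_def\<close>)
    moreover have "1 \<le> M * G" using M G by (cases M; cases G) auto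
    ultimately show ?thesis using ops by (simp add: algebra_simps)
  qed
  show ?thesis
    unfolding member_prog_def body_def[symmetric]
    by (intro wp_Seq wp_Assign, rule wp_conseq[OF loop])
      (use assms(1) time in \<open>auto simp: k_def L_def\<close>)
qed

section \<open>The paging instance\<close>

text \<open>
  Elements keep their names as pages. Sets follow in reverse order, so that pushing their costs
  onto a list one after the other yields the list of page costs.
\<close>

definition set_page :: "setcover \<Rightarrow> nat \<Rightarrow> nat" where
  "set_page I j = num_elems I + (num_sets I - Suc j)"

definition conflict :: "setcover \<Rightarrow> nat set \<Rightarrow> bool" where
  "conflict I T \<longleftrightarrow>
     (\<exists>x\<in>T. x < num_elems I \<and> (\<forall>j<num_sets I. x \<in> set_of I j \<longrightarrow> set_page I j \<in> T))"

text \<open>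
  The threshold 2 makes all singletons feasible, even those of elements that lie in no set, whereas
  a conflict at a coverable element involves at least two pages and has value at least 4. Without
  pages the threshold is 0, because then the instance must have size 0.
\<close>

definition paging_of :: "setcover \<Rightarrow> paging" where
  "paging_of I =
     \<lparr>num_pages = num_elems I + num_sets I,
      page_cost = (\<lambda>p. if num_elems I \<le> p \<and> p < num_elems I + num_sets I
         then set_cost I (num_elems I + num_sets I - Suc p) else 0),
      feas = (\<lambda>T. if conflict I T then 2 ^ card T else 0),
      threshold = (if num_elems I + num_sets I = 0 then 0 else 2)\<rparr>"

definition page_requests :: "setcover \<Rightarrow> nat list" where
  "page_requests I = map (set_page I) [0..<num_sets I]"

section \<open>Validity of the paging instance\<close>

lemma pages_paging_of: "pages (paging_of I) = {..<num_elems I + num_sets I}"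
  by (simp add: pages_def paging_of_def)

lemma page_cost_set_page: "j < num_sets I \<Longrightarrow> page_cost (paging_of I) (set_page I j) = set_cost I j"
  by (simp add: paging_of_def set_page_def)

lemma page_cost_nonneg: "valid_setcover I \<Longrightarrow> 0 \<le> page_cost (paging_of I) p"
  by (auto simp: paging_of_def valid_setcover_def)

lemma inj_on_set_page: "inj_on (set_page I) {..<num_sets I}"
  by (auto simp: inj_on_def set_page_def)

lemma set_page_less: "j < num_sets I \<Longrightarrow> set_page I j < num_elems I + num_sets I"
  and set_page_ge: "num_elems I \<le> set_page I j"
  by (auto simp: set_page_def)

lemma conflict_mono: "conflict I S \<Longrightarrow> S \<subseteq> T \<Longrightarrow> conflict I T"
  unfolding conflict_def by blast

text \<open>If neither of two conflicting sets contains the other, their union has at least one element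
  more than each of them, so a single power of two dominates the sum of the two.\<close>

lemma supermodular_pow_card:
  assumes up: "\<And>S T. C S \<Longrightarrow> S \<subseteq> T \<Longrightarrow> C T" and "finite P"
  shows "supermodular_on P (\<lambda>T. if C T then 2 ^ card T else 0)"
  unfolding supermodular_on_def
proof (intro allI impI)
  fix S S' assume "S \<subseteq> P" "S' \<subseteq> P"
  with \<open>finite P\<close> have fin: "finite S" "finite S'" using finite_subset by auto
  let ?f = "\<lambda>T. if C T then 2 ^ card T else 0 :: nat"
  have mono: "?f A \<le> ?f B" if "A \<subseteq> B" "finite B" for A B
    using that up[of A B] by (auto intro!: power_increasing card_mono)
  consider "S \<subseteq> S'" | "S' \<subseteq> S" | "\<not> S \<subseteq> S'" "\<not> S' \<subseteq> S" by blast
  then show "?f S + ?f S' \<le> ?f (S \<union> S') + ?f (S \<inter> S')"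
  proof cases
    case 1
    then show ?thesis by (simp add: Un_absorb1 Int_absorb2)
  next
    case 2
    then show ?thesis by (simp add: Un_absorb2 Int_absorb1)
  next
    case 3
    show ?thesis
    proof (cases "C S \<and> C S'")
      case True
      have "card S < card (S \<union> S')" "card S' < card (S \<union> S')"
        using 3 fin by (auto intro!: psubset_card_mono)
      then have "(2::nat) ^ Suc (card S) \<le> 2 ^ card (S \<union> S')"
        "(2::nat) ^ Suc (card S') \<le> 2 ^ card (S \<union> S')"
        by (auto intro!: power_increasing simp del: power_Suc)
      moreover have "C (S \<union> S')" using True up by blast
      ultimately show ?thesis using True by simp
    next
      case False
      then have "?f S = 0 \<or> ?f S' = 0" by auto
      with mono[of S "S \<union> S'"] mono[of S' "S \<union> S'"] fin show ?thesis by fastforce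
    qed
  qed
qed

lemma valid_paging_of:
  assumes "valid_setcover I"
  shows "valid_paging (paging_of I)"
  unfolding valid_paging_def
proof (intro conjI ballI)
  let ?P = "pages (paging_of I)"
  have fin: "finite ?P" by (simp add: pages_paging_of)
  have feas: "feas (paging_of I) = (\<lambda>T. if conflict I T then 2 ^ card T else 0)"
    by (simp add: paging_of_def)
  show "0 \<le> page_cost (paging_of I) p" for p
    using assms by (rule page_cost_nonneg)
  show "mono_on (Pow ?P) (feas (paging_of I))"
  proof (rule mono_onI)
    fix S T assume "S \<in> Pow ?P" "T \<in> Pow ?P" "S \<subseteq> T"
    then have "finite T" using fin finite_subset by auto
    with \<open>S \<subseteq> T\<close> show "feas (paging_of I) S \<le> feas (paging_of I) T"
      using conflict_mono[of I S T] by (auto simp: feas intro!: power_increasing card_mono)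
  qed
  show "supermodular_on ?P (feas (paging_of I))"
    unfolding feas by (rule supermodular_pow_card) (use conflict_mono fin in auto)
  show "feas (paging_of I) {p} \<le> threshold (paging_of I)" if "p \<in> ?P" for p
    using that unfolding pages_paging_of by (auto simp: paging_of_def)
qed

lemma set_page_requests: "set (page_requests I) = set_page I ` {..<num_sets I}"
  by (auto simp: page_requests_def)

lemma paging_input_of:
  assumes "setcover_input I xs"
  shows "paging_input (paging_of I) (page_requests I @ xs)"
proof -
  have "x < num_elems I" if "x \<in> set xs" for x
    using assms that by (fastforce simp: setcover_input_def covered_def valid_setcover_def)
  then show ?thesis
    using assms valid_paging_of set_page_less
    by (force simp: paging_input_def setcover_input_def pages_paging_of set_page_requests)
qed

section \<open>Size of the paging instance\<close>

lemma bits_pow2: "bits (2 ^ k) = replicate k False @ [True]"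
proof (induction k)
  case 0
  show ?case by (subst bits.simps) (simp add: bits.simps[of 0])
next
  case (Suc k)
  then show ?case by (subst bits.simps) simp
qed

lemma bits_0 [simp]: "bits 0 = []"
  by (simp add: bits.simps)

lemma num_den_0: "num_den 0 = (0, 1)"
  by (simp add: num_den_def)

text \<open>An element accounts for a page, a zero cost of length 1, and 2 units in each of the
  bounds for the threshold and the largest value; a set accounts for a page, a request and the same
  4 units. This makes 6 in both cases, without an additive constant.\<close>

lemma paging_size_of:
  assumes "valid_setcover I"
  shows "paging_size (paging_of I) (page_requests I @ xs) \<le> 6 * setcover_size I xs"
proof -
  let ?n = "num_elems I" and ?m = "num_sets I"
  let ?R = "\<Sum>j<?m. rat_length (set_cost I j)"
  have r0: "rat_length 0 = 1"
    using bits_pow2[of 0] by (simp add: rat_length_def num_den_0)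
  have "(\<Sum>p<?n + ?m. rat_length (page_cost (paging_of I) p)) =
      (\<Sum>p<?n. rat_length (page_cost (paging_of I) p)) +
      (\<Sum>p\<in>{?n..<?n + ?m}. rat_length (page_cost (paging_of I) p))"
    unfolding atLeast0LessThan[symmetric] by (rule sum.atLeastLessThan_concat[symmetric]) auto
  also have "(\<Sum>p<?n. rat_length (page_cost (paging_of I) p)) = ?n"
    by (simp add: paging_of_def r0)
  also have "(\<Sum>p\<in>{?n..<?n + ?m}. rat_length (page_cost (paging_of I) p)) = ?R"
    by (rule sum.reindex_bij_witness[of _ "set_page I" "\<lambda>p. ?n + ?m - Suc p"])
      (auto simp: set_page_def paging_of_def)
  finally have costs: "(\<Sum>p<?n + ?m. rat_length (page_cost (paging_of I) p)) = ?n + ?R" .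
  have "length (bits 2) = 2" using bits_pow2[of 1] by simp
  then have thr: "length (bits (threshold (paging_of I))) \<le> 2 * (?n + ?m)"
    by (auto simp: paging_of_def)
  \<comment> \<open>With \<open>N \<ge> 1\<close> pages the largest value has at most
    \<open>N + 1 \<le> 2 * N\<close> bits. Without pages it is 0, because the empty collection has
    no conflict.\<close>
  have "\<not> conflict I {}" by (simp add: conflict_def)
  then have top: "length (bits (feas (paging_of I) (pages (paging_of I)))) \<le> 2 * (?n + ?m)"
    unfolding pages_paging_of by (cases "?n + ?m = 0") (auto simp: paging_of_def bits_pow2)
  have "?n + ?m + ?R + length xs \<le> setcover_size I xs"
    unfolding setcover_size_def sum.distrib by simp
  moreover have "paging_size (paging_of I) (page_requests I @ xs) =
      (?n + ?m) + (?n + ?R) + length (bits (threshold (paging_of I))) +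
      length (bits (feas (paging_of I) (pages (paging_of I)))) + (?m + length xs)"
    using costs by (simp add: paging_size_def page_requests_def) (simp add: paging_of_def)
  moreover have "?R \<le> 6 * ?R" "length xs \<le> 6 * length xs" by simp_all
  ultimately show ?thesis using thr top unfolding add_mult_distrib2 by linarith
qed

section \<open>The paging optimum is at most the set cover optimum\<close>

lemma schedule_no_evictions:
  assumes "\<And>T. T \<subseteq> S \<union> set ps \<Longrightarrow> feas J T \<le> threshold J"
    and "schedule J (S \<union> set ps) qs Es"
  shows "schedule J S (ps @ qs) (replicate (length ps) {} @ Es)"
  using assms
proof (induction ps arbitrary: S)
  case (Cons p ps)
  then show ?case
    using Cons.IH[of "insert p S"] Cons.prems(1)[of "insert p S"]
    by (simp add: subset_insertI2 insert_mono)
qed simp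

lemma paging_opt_le:
  assumes "setcover_input I xs"
  shows "paging_opt (paging_of I) (page_requests I @ xs) \<le> setcover_opt I xs"
  unfolding setcover_opt_def
proof (rule INF_greatest)
  let ?J = "paging_of I" and ?S = "set (page_requests I)"
  fix C assume "C \<in> {C. C \<subseteq> {..<num_sets I} \<and> set xs \<subseteq> covered I C}"
  then have C: "C \<subseteq> {..<num_sets I}" "set xs \<subseteq> covered I C" by auto
  have val: "valid_setcover I" using assms by (simp add: setcover_input_def)
  have xs: "x < num_elems I" if "x \<in> set xs" for x
    using val C that by (fastforce simp: covered_def valid_setcover_def)
  have ok: "feas ?J T \<le> threshold ?J" if "\<not> conflict I T" for T
    using that by (simp add: paging_of_def)
  \<comment> \<open>While the sets are loaded, the cache contains no element, and a conflict needs
    one.\<close>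
  have ok1: "feas ?J T \<le> threshold ?J" if "T \<subseteq> {} \<union> ?S" for T
    by (rule ok) (use that set_page_ge[of I] in
      \<open>auto simp: conflict_def set_page_requests dest!: subsetD simp flip: not_le\<close>)
  \<comment> \<open>An element in conflict would be among the requests, so \<open>C\<close> has a
    set containing it. The page of this set has been evicted, and it is not requested again because
    set pages start at \<open>num_elems I\<close>.\<close>
  have ok2: "feas ?J T \<le> threshold ?J" if "T \<subseteq> (?S - set_page I ` C) \<union> set xs" for T
  proof (rule ok, rule notI)
    assume "conflict I T"
    then obtain x where x: "x \<in> T" "x < num_elems I"
      "\<And>j. j < num_sets I \<Longrightarrow> x \<in> set_of I j \<Longrightarrow> set_page I j \<in> T"
      by (auto simp: conflict_def)
    have "x \<in> set xs"
      using that x(1,2) set_page_ge[of I]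
      by (auto simp: set_page_requests dest!: subsetD simp flip: not_le)
    with C obtain j where j: "j \<in> C" "x \<in> set_of I j" by (auto simp: covered_def)
    with x(3) C have "set_page I j \<in> T" by auto
    with that j(1) have "set_page I j \<in> set xs" by auto
    with xs[of "set_page I j"] set_page_ge[of I j] show False by simp
  qed
  obtain Es where Es: "schedule ?J {} (page_requests I @ xs) Es"
    and cost: "eviction_cost ?J Es \<le> cover_cost I C"
  proof (cases xs)
    \<comment> \<open>Without element requests there is no moment at which to evict
      \<open>C\<close>; evicting nothing is at least as cheap.\<close>
    case Nil
    have "schedule ?J {} (page_requests I @ []) (replicate (length (page_requests I)) {} @ [])"
      by (rule schedule_no_evictions[OF ok1]) auto
    moreover have "0 \<le> cover_cost I C"
      unfolding cover_cost_def by (rule sum_nonneg) (use val C in \<open>auto simp: valid_setcover_def\<close>)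
    ultimately show ?thesis
      using that Nil by (simp add: eviction_cost_def sum_list_replicate)
  next
    case (Cons x ys)
    let ?E = "set_page I ` C"
    have "x \<notin> ?E" "x \<notin> ?S" using xs[of x] Cons set_page_ge[of I]
      by (auto simp: set_page_requests simp flip: not_le)
    moreover have "?E \<subseteq> ?S" using C by (auto simp: set_page_requests)
    moreover have "schedule ?J (insert x ?S - ?E) (ys @ []) (replicate (length ys) {} @ [])"
      by (rule schedule_no_evictions) (auto intro!: ok2 simp: Cons)
    moreover have "feas ?J (insert x ?S - ?E) \<le> threshold ?J"
      by (rule ok2) (auto simp: Cons)
    ultimately have "schedule ?J ({} \<union> ?S) xs (?E # replicate (length ys) {})"
      by (auto simp: Cons)
    from schedule_no_evictions[OF ok1 this]
    have "schedule ?J {} (page_requests I @ xs)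
      (replicate (length (page_requests I)) {} @ ?E # replicate (length ys) {})" by simp
    moreover have "(\<Sum>p\<in>?E. page_cost ?J p) = cover_cost I C"
      unfolding cover_cost_def
      by (subst sum.reindex)
        (use C inj_on_subset[OF inj_on_set_page] page_cost_set_page in \<open>auto intro!: sum.cong\<close>)
    ultimately show ?thesis
      using that by (simp add: eviction_cost_def sum_list_replicate)
  qed
  from Es show "paging_opt ?J (page_requests I @ xs) \<le> ennreal (real_of_rat (cover_cost I C))"
    unfolding paging_opt_def
    by (rule INF_lower2[OF CollectI]) (use cost in \<open>simp add: of_rat_less_eq ennreal_leI\<close>)
qed

text \<open>A page present at first or requested in \<open>ps\<close> can be missing from the later
  cache \<open>S'\<close> only because it was evicted meanwhile. The inclusion tolerates pages that
  were evicted and fetched again.\<close>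

lemma schedule_append:
  assumes "schedule J S (ps @ qs) Es" and "finite S"
  shows "\<exists>Es1 Es2 S'. Es = Es1 @ Es2 \<and> length Es1 = length ps \<and> schedule J S' qs Es2 \<and>
    finite S' \<and> S \<union> set ps \<subseteq> S' \<union> \<Union> (set Es1)"
  using assms
proof (induction ps arbitrary: S Es)
  case Nil
  then show ?case by (intro exI[of _ "[]"] exI[of _ Es] exI[of _ S]) auto
next
  case (Cons p ps)
  then obtain E Fs where E: "Es = E # Fs" by (cases Es) auto
  with Cons.prems have "schedule J (insert p S - E) (ps @ qs) Fs" "finite (insert p S - E)" by auto
  from Cons.IH[OF this] obtain Es1 Es2 S' where
    "Fs = Es1 @ Es2" "length Es1 = length ps" "schedule J S' qs Es2" "finite S'"
    "(insert p S - E) \<union> set ps \<subseteq> S' \<union> \<Union> (set Es1)" by blast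
  then show ?case
    by (intro exI[of _ "E # Es1"] exI[of _ Es2] exI[of _ S']) (auto simp: E)
qed

text \<open>The answers \<open>js\<close> to the requests \<open>xs\<close> name sets whose pages have been evicted, whenever this
  is possible; \<open>D\<close> are the evictions before \<open>xs\<close>, and \<open>Es\<close> those during \<open>xs\<close>.\<close>

fun follows :: "setcover \<Rightarrow> nat set \<Rightarrow> nat list \<Rightarrow> nat set list \<Rightarrow> nat list \<Rightarrow> bool" where
  "follows I D [] [] [] = True"
| "follows I D (x # xs) (E # Es) (j # js) =
     (((\<exists>i<num_sets I. x \<in> set_of I i \<and> set_page I i \<in> D \<union> E) \<longrightarrow>
        j < num_sets I \<and> x \<in> set_of I j \<and> set_page I j \<in> D \<union> E) \<and>
      follows I (D \<union> E) xs Es js)"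
| "follows I D _ _ _ = False"

lemma evicted_cover:
  assumes feas: "feas (paging_of I) T \<le> threshold (paging_of I)"
    and "finite T" "x \<in> T" "x < num_elems I" "x \<in> covered I {..<num_sets I}"
  shows "\<exists>j<num_sets I. x \<in> set_of I j \<and> set_page I j \<notin> T"
proof (rule ccontr)
  assume "\<not> ?thesis"
  with assms have c: "conflict I T" by (auto simp: conflict_def)
  from assms obtain j where "j < num_sets I" "x \<in> set_of I j" by (auto simp: covered_def)
  with \<open>\<not> ?thesis\<close> have "{x, set_page I j} \<subseteq> T" using assms by auto
  moreover have "x \<noteq> set_page I j" using assms(4) set_page_ge[of I j] by auto
  \<comment> \<open>Two distinct pages suffice: a conflicting \<open>T\<close> then has value at
    least 4, above both possible thresholds 0 and 2.\<close>
  ultimately have "2 \<le> card T"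
    using card_mono[OF \<open>finite T\<close>, of "{x, set_page I j}"] by simp
  then have "(2::nat) ^ 2 \<le> 2 ^ card T" by (intro power_increasing) auto
  with feas c show False by (simp add: paging_of_def split: if_splits)
qed

text \<open>Invariant: every set page is in the cache \<open>S\<close> or among the past evictions
  \<open>D\<close>. Feasibility keeps some set containing \<open>x\<close> out of the cache, so its
  page has been evicted, and \<open>follows\<close> then forces the answer to be a set of this
  kind.\<close>

lemma follows_schedule:
  assumes "follows I D xs Es js" and "schedule (paging_of I) S xs Es" and "finite S"
    and "set_page I ` {..<num_sets I} \<subseteq> S \<union> D" and "set xs \<subseteq> {..<num_elems I}"
    and "set xs \<subseteq> covered I {..<num_sets I}"
  shows "list_all2 (\<lambda>x j. j < num_sets I \<and> x \<in> set_of I j) xs js \<and>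
    set_page I ` set js \<subseteq> D \<union> \<Union> (set Es)"
  using assms
proof (induction I D xs Es js arbitrary: S rule: follows.induct)
  case (2 I D x xs E Es j js)
  let ?T = "insert x S - E"
  from 2(3) have E: "E \<subseteq> S - {x}" and T: "feas (paging_of I) ?T \<le> threshold (paging_of I)"
    and rest: "schedule (paging_of I) ?T xs Es" by auto
  have "\<exists>i<num_sets I. x \<in> set_of I i \<and> set_page I i \<notin> ?T"
    by (rule evicted_cover[OF T]) (use 2 E in auto)
  then obtain i where i: "i < num_sets I" "x \<in> set_of I i" "set_page I i \<notin> ?T" by blast
  then have "set_page I i \<in> D \<union> E" using 2(5) by auto
  with 2(2) i have j: "j < num_sets I" "x \<in> set_of I j" "set_page I j \<in> D \<union> E" by auto
  have "list_all2 (\<lambda>x j. j < num_sets I \<and> x \<in> set_of I j) xs js \<and>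
    set_page I ` set js \<subseteq> (D \<union> E) \<union> \<Union> (set Es)"
    by (rule 2(1)[OF _ rest]) (use 2 in auto)
  with j show ?case by auto
qed auto

section \<open>Cost of the chosen sets\<close>

lemma choices_ok_if_contained:
  "list_all2 (\<lambda>x j. j < num_sets I \<and> x \<in> set_of I j) xs js \<Longrightarrow> choices_ok I C xs js"
  by (induction xs js arbitrary: C rule: list_all2_induct) auto

lemma chosen_subset: "chosen I C xs js \<subseteq> C \<union> set js"
  by (induction I C xs js rule: chosen.induct) auto

text \<open>A page evicted several times is paid each time but counted once in the union.\<close>

lemma sum_Union_le_eviction_cost:
  assumes "\<And>p. 0 \<le> page_cost J p" and "\<And>E. E \<in> set Es \<Longrightarrow> finite E"
  shows "(\<Sum>p\<in>\<Union> (set Es). page_cost J p) \<le> eviction_cost J Es"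
  using assms(2)
proof (induction Es)
  case (Cons E Es)
  have "(\<Sum>p\<in>E \<union> \<Union> (set Es). page_cost J p) \<le>
      (\<Sum>p\<in>E. page_cost J p) + (\<Sum>p\<in>\<Union> (set Es). page_cost J p)"
    using Cons.prems by (subst sum.union_inter[symmetric]) (auto intro!: sum_nonneg assms(1))
  with Cons show ?case by (simp add: eviction_cost_def)
qed (simp add: eviction_cost_def)

text \<open>Sets may be evicted already while they are loaded. The answers \<open>vs1\<close> to
  these requests therefore enter the cost and provide the initial evictions of
  \<open>follows\<close>.\<close>

lemma follows_competitive:
  assumes inp: "setcover_input I xs"
    and sched: "schedule (paging_of I) {} (page_requests I @ xs) (map dec_names (vs1 @ vs2))"
    and len: "length vs1 = num_sets I"
    and fol: "follows I (\<Union> (dec_names ` set vs1)) xs (map dec_names vs2) js"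
  shows "choices_ok I {} xs js"
    and "cover_cost I (chosen I {} xs js) \<le>
      eviction_cost (paging_of I) (map dec_names (vs1 @ vs2))"
proof -
  let ?J = "paging_of I" and ?D = "\<Union> (dec_names ` set vs1)"
  have val: "valid_setcover I" using inp by (simp add: setcover_input_def)
  from schedule_append[OF sched] obtain Es1 Es2 S where
    Es: "map dec_names (vs1 @ vs2) = Es1 @ Es2" "length Es1 = num_sets I" "schedule ?J S xs Es2"
      "finite S" "set (page_requests I) \<subseteq> S \<union> \<Union> (set Es1)"
    by (auto simp: page_requests_def)
  then have "Es1 = map dec_names vs1" "Es2 = map dec_names vs2"
    using len by (auto simp: append_eq_append_conv)
  with Es have S: "schedule ?J S xs (map dec_names vs2)" "set_page I ` {..<num_sets I} \<subseteq> S \<union> ?D"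
    by (auto simp: set_page_requests)
  have "set xs \<subseteq> {..<num_elems I}" "set xs \<subseteq> covered I {..<num_sets I}"
    using inp by (fastforce simp: setcover_input_def covered_def valid_setcover_def)+
  from follows_schedule[OF fol S(1) \<open>finite S\<close> S(2) this]
  have ok: "list_all2 (\<lambda>x j. j < num_sets I \<and> x \<in> set_of I j) xs js"
    and sub: "set_page I ` set js \<subseteq> \<Union> (set (map dec_names (vs1 @ vs2)))" by auto
  from ok show "choices_ok I {} xs js" by (rule choices_ok_if_contained)
  have js: "set js \<subseteq> {..<num_sets I}"
    using ok by (force simp: list_all2_conv_all_nth in_set_conv_nth)
  let ?C = "chosen I {} xs js"
  have C: "?C \<subseteq> set js" using chosen_subset[of I "{}"] by simp
  have "cover_cost I ?C = (\<Sum>p\<in>set_page I ` ?C. page_cost ?J p)"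
    unfolding cover_cost_def
    by (subst sum.reindex)
      (use C js inj_on_subset[OF inj_on_set_page] page_cost_set_page in \<open>auto intro!: sum.cong\<close>)
  also have "\<dots> \<le> (\<Sum>p\<in>\<Union> (set (map dec_names (vs1 @ vs2))). page_cost ?J p)"
    by (rule sum_mono2) (use C sub page_cost_nonneg[OF val] in auto)
  also have "\<dots> \<le> eviction_cost ?J (map dec_names (vs1 @ vs2))"
    by (rule sum_Union_le_eviction_cost) (use page_cost_nonneg[OF val] in auto)
  finally show "cover_cost I ?C \<le> eviction_cost ?J (map dec_names (vs1 @ vs2))" .
qed

section \<open>Evaluating the feasibility function\<close>

definition ctx :: "setcover \<Rightarrow> store \<Rightarrow> bool" where
  "ctx I s \<longleftrightarrow> s vInst = enc_setcover I \<and> s vPages = enc_name (num_elems I + num_sets I)"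

text \<open>A positive strict upper bound for all page and element names and for the length of every
  list of elements; being positive, it lets products absorb additive constants.\<close>

definition width :: "setcover \<Rightarrow> nat" where
  "width I = Suc (num_elems I + num_sets I)"

definition enc_member :: "setcover \<Rightarrow> nat \<Rightarrow> val" where
  "enc_member I j = Cell (enc_rat (set_cost I j))
     (enc_list (map enc_name (sorted_list_of_set (set_of I j))))"

lemma enc_setcover_alt:
  "enc_setcover I = Cell (enc_name (num_elems I)) (enc_list (map (enc_member I) [0..<num_sets I]))"
  by (simp add: enc_setcover_def enc_member_def[abs_def])

lemma ctxD:
  assumes "ctx I s"
  shows "vhd (s vInst) = enc_name (num_elems I)"
    and "vtl (s vInst) = enc_list (map (enc_member I) [0..<num_sets I])"
    and "s vPages = enc_name (num_elems I + num_sets I)"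
  using assms by (simp_all add: ctx_def enc_setcover_alt)

lemma enc_member_elems:
  assumes "valid_setcover I" "j < num_sets I"
  shows "dec_names (vtl (enc_member I j)) = set_of I j"
    and "dec_name (vtl (enc_member I j)) < width I"
proof -
  have sub: "set_of I j \<subseteq> {..<num_elems I}" using assms by (auto simp: valid_setcover_def)
  then have "finite (set_of I j)" using finite_subset by blast
  then show "dec_names (vtl (enc_member I j)) = set_of I j"
    by (simp add: enc_member_def image_image)
  show "dec_name (vtl (enc_member I j)) < width I"
    using card_mono[OF _ sub] by (simp add: enc_member_def width_def)
qed

text \<open>The strict inequality \<open>m < M\<close> leaves a spare summand
  \<open>(8 + c) * X\<close>, which absorbs the 2 units of the final test; 8 is 2 + 6.\<close>

lemma loop_bound:
  assumes "m < M" "1 \<le> X" "b \<le> c * X"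
  shows "2 + (6 + b) * m \<le> (8 + c) * (M * X :: nat)"
proof -
  have "2 + (6 + b) * m \<le> 2 * X + (6 * X + c * X) * m"
    by (intro add_mono mult_right_mono) (use assms in auto)
  also have "\<dots> \<le> (8 + c) * (Suc m * X)" by (simp add: algebra_simps)
  also have "\<dots> \<le> (8 + c) * (M * X)"
    by (intro mult_left_mono mult_right_mono) (use assms in auto)
  finally show ?thesis .
qed

text \<open>"Free" means causing no conflict. \<open>vPage\<close> starts at the number of pages and
  is decremented before each set, so with the descending numbering of \<open>set_page\<close> the
  page of the next set is a single \<open>ETl\<close> away.\<close>

definition free_prog :: com where
  "free_prog =
     Assign vFree ETrue ;; member_prog (EVar vElem) (EVar vQuery) ;;
     Cond (EVar vFound) (Assign vFree EAtom) Skip ;;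
     Assign vPage (EVar vPages) ;; Assign vSets (ETl (EVar vInst)) ;;
     for_each vSets
       (Assign vPage (ETl (EVar vPage)) ;;
        member_prog (EVar vElem) (ETl (EHd (EVar vSets))) ;;
        Cond (EVar vFound)
          (member_prog (EVar vPage) (EVar vQuery) ;;
           Cond (EVar vFound) Skip (Assign vFree ETrue))
          Skip)"

lemma mods_free_prog [simp]:
  "mods free_prog = {vFree, vPage, vSets, vKey, vList, vFound, vLeft, vRight}"
  by (auto simp: free_prog_def)

lemma free_free_prog [simp]: "toss_free free_prog" "query_free free_prog"
  by (simp_all add: free_prog_def)

text \<open>\<open>G\<close> exceeds the length of the query and of every list of elements, so one
  bound serves for both kinds of membership test.\<close>

lemma wp_free_prog:
  assumes val: "valid_setcover I" and ctx: "ctx I s"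
    and elem: "dec_name (s vElem) < width I"
    and G: "dec_name (s vQuery) + width I \<le> G"
  shows "wp free_prog s
     (\<lambda>s' t. t \<le> 300 * (width I * (width I * G)) \<and>
        (s' vFree \<noteq> Atom \<longleftrightarrow> dec_name (s vElem) \<notin> dec_names (s vQuery) \<or>
          (\<exists>j<num_sets I. dec_name (s vElem) \<in> set_of I j \<and>
             set_page I j \<notin> dec_names (s vQuery))))"
proof -
  let ?M = "width I" and ?n = "num_elems I" and ?m = "num_sets I"
  define x where "x = dec_name (s vElem)"
  define T where "T = dec_names (s vQuery)"
  define body where "body =
     Assign vPage (ETl (EVar vPage)) ;;
     member_prog (EVar vElem) (ETl (EHd (EVar vSets))) ;;
     Cond (EVar vFound)
       (member_prog (EVar vPage) (EVar vQuery) ;;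
        Cond (EVar vFound) Skip (Assign vFree ETrue))
       Skip"
  \<comment> \<open>\<open>60 * Z\<close> pays for one membership test. A round makes at most two of
    them, and its other code fits into \<open>30 * Z\<close>; hence the 150 below.\<close>
  define Z where "Z = ?M * G"
  have MG: "1 \<le> Z" using G by (simp add: Z_def width_def)
  define Inv where "Inv j s' \<longleftrightarrow> dec_name (s' vPage) = ?n + ?m - j \<and>
      (s' vFree \<noteq> Atom \<longleftrightarrow> x \<notin> T \<or> (\<exists>i<j. x \<in> set_of I i \<and> set_page I i \<notin> T))" for j s'
  have loop: "wp (for_each vSets body) s1
      (\<lambda>s' t. t \<le> 2 + (6 + 150 * Z) * ?m \<and> Inv ?m s')"
    if s1: "s1 vSets = vtl (s vInst)" "s1 vElem = s vElem" "s1 vQuery = s vQuery" "Inv 0 s1" for s1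
  proof (rule wp_for_each_enc_list)
    show "s1 vSets = enc_list (map (enc_member I) [0..<?m])"
      using s1(1) ctxD[OF ctx] by simp
    show "Inv 0 s1" by fact
    show "vSets \<notin> mods body" by (simp add: body_def)
    fix s2 j
    assume j: "j < ?m" and hd: "vhd (s2 vSets) = enc_member I j" and inv: "Inv j s2"
      and frame: "\<And>y. y \<noteq> vSets \<Longrightarrow> y \<notin> mods body \<Longrightarrow> s2 y = s1 y"
    have s2: "s2 vElem = s vElem" "s2 vQuery = s vQuery"
      using frame[of vElem] frame[of vQuery] s1(2,3) by (simp_all add: body_def)
    have page: "dec_name (s2 vPage) - 1 = set_page I j"
      using inv j by (simp add: Inv_def set_page_def)
    have less: "set_page I j < ?M" using set_page_less[OF j] by (simp add: width_def)
    note el = enc_member_elems[OF val j]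
    have ex: "(\<exists>i<Suc j. P i) \<longleftrightarrow> P j \<or> (\<exists>i<j. P i)" for P by (auto simp: less_Suc_eq)
    show "wp body s2 (\<lambda>s'' t. t \<le> 150 * Z \<and> (\<forall>u. Inv (Suc j) (s''(vSets := u))))"
      unfolding body_def
      apply (intro wp_Seq wp_Assign)
      apply (rule wp_conseq[OF wp_member_prog[where M = ?M and G = G]])
      using elem el(2) G apply (simp_all add: s2 hd)[4]
      apply (rule wp_Cond)
      apply (rule wp_Seq)
      apply (rule wp_conseq[OF wp_member_prog[where M = ?M and G = G]])
      using elem el(2) G page less apply (simp_all add: s2 hd width_def)[4]
      subgoal using inv MG page by (intro wp_intros) (auto simp: s2 hd el ex Inv_def T_def x_def Z_def[symmetric])
      subgoal using inv MG page by (intro wp_intros) (auto simp: s2 hd el ex Inv_def T_def x_def Z_def[symmetric])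
      done
  qed
  define W where "W = ?M * Z"
  have b: "2 + (6 + 150 * Z) * ?m \<le> (8 + 150) * W"
    unfolding W_def by (rule loop_bound) (use MG in \<open>auto simp: width_def\<close>)
  have b': "Z \<le> W" by (simp add: W_def width_def)
  show ?thesis
    unfolding free_prog_def body_def[symmetric]
    apply (intro wp_Seq wp_Assign)
    apply (rule wp_conseq[OF wp_member_prog[where M = ?M and G = G]])
    using elem G apply (simp_all add: width_def)[4]
    apply (rule wp_Seq, rule wp_Cond)
    subgoal
      apply (intro wp_Seq wp_Assign)
      apply (rule wp_conseq[OF loop])
      using b b' MG ctxD[OF ctx]
      by (auto simp: Inv_def T_def x_def Z_def[symmetric] W_def[symmetric])
    subgoal
      apply (intro wp_Seq wp_Assign wp_Skip)
      apply (rule wp_conseq[OF loop])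
      using b b' MG ctxD[OF ctx]
      by (auto simp: Inv_def T_def x_def Z_def[symmetric] W_def[symmetric])
    done
qed

text \<open>The cardinality is found by testing every page against the query rather than by
  traversing the query, which may repeat names or contain names of no page. The result starts as 1;
  since the least significant bit comes first, prepending a zero bit doubles it for each page
  found.\<close>

definition oracle_prog :: com where
  "oracle_prog =
     Assign vConflict EAtom ;; Assign vCount (EHd (EVar vInst)) ;;
     for_each vCount
       (Assign vElem (ETl (EVar vCount)) ;; free_prog ;;
        Cond (EVar vFree) Skip (Assign vConflict ETrue)) ;;
     Assign vResult (ECell ETrue EAtom) ;; Assign vCount (EVar vPages) ;;
     for_each vCount
       (member_prog (ETl (EVar vCount)) (EVar vQuery) ;;
        Cond (EVar vFound) (Assign vResult (ECell EAtom (EVar vResult))) Skip) ;;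
     Cond (EVar vConflict) Skip (Assign vResult EAtom)"

lemma mods_oracle_prog [simp]:
  "mods oracle_prog = {vConflict, vCount, vElem, vResult} \<union> mods free_prog"
  by (auto simp: oracle_prog_def)

lemma free_oracle_prog [simp]: "toss_free oracle_prog" "query_free oracle_prog"
  by (simp_all add: oracle_prog_def)

lemma enc_nat_pow2_Suc: "enc_nat (2 ^ Suc k) = Cell Atom (enc_nat (2 ^ k))"
  by (simp add: enc_nat_def bits_pow2 enc_bool_def del: power_Suc)

lemma enc_nat_0: "enc_nat 0 = Atom"
  and enc_nat_1: "enc_nat 1 = Cell (Cell Atom Atom) Atom"
  using bits_pow2[of 0] by (simp_all add: enc_nat_def enc_bool_def)

text \<open>The time is linear in the length of the query, with which the paging algorithm is
  charged anyway. The four widths stem from the loop over elements, the loop over sets, the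
  comparison of names, and \<open>G\<close>, which is at most a width times one plus the length of
  the query.\<close>

lemma wp_oracle_prog:
  assumes val: "valid_setcover I" and ctx: "ctx I s"
  shows "wp oracle_prog s
     (\<lambda>s' t. t \<le> 500 * (width I ^ 4 * (1 + dec_name (s vQuery))) \<and>
        s' vResult = feas_oracle (paging_of I) (s vQuery))"
proof -
  let ?M = "width I" and ?n = "num_elems I" and ?m = "num_sets I"
  define G where "G = dec_name (s vQuery) + ?M"
  define T where "T = dec_names (s vQuery)"
  define Y where "Y = ?M * (?M * G)"
  define bad where "bad x \<longleftrightarrow> x \<in> T \<and> (\<forall>j<?m. x \<in> set_of I j \<longrightarrow> set_page I j \<in> T)" for x
  have Y1: "1 \<le> Y" and YG: "?M * G \<le> Y" by (auto simp: Y_def G_def width_def)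
  define body1 where "body1 =
     Assign vElem (ETl (EVar vCount)) ;; free_prog ;;
     Cond (EVar vFree) Skip (Assign vConflict ETrue)"
  define body2 where "body2 =
     member_prog (ETl (EVar vCount)) (EVar vQuery) ;;
     Cond (EVar vFound) (Assign vResult (ECell EAtom (EVar vResult))) Skip"
  \<comment> \<open>Both counters run downwards: elements below \<open>dec_name v\<close> are still
    to be tested, and in \<open>Inv2\<close> the pages from \<open>dec_name v\<close> on have been
    counted.\<close>
  define Inv1 where "Inv1 v s' \<longleftrightarrow> dec_name v \<le> ?n \<and>
      (s' vConflict \<noteq> Atom \<or> (\<exists>x<dec_name v. bad x) \<longleftrightarrow> (\<exists>x<?n. bad x))" for v s'
  define Inv2 where "Inv2 v s' \<longleftrightarrow> dec_name v \<le> ?n + ?m \<and>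
      s' vResult = enc_nat (2 ^ card (T \<inter> {dec_name v..<?n + ?m}))" for v s'
  have ex: "(\<exists>i<Suc j. P i) \<longleftrightarrow> P j \<or> (\<exists>i<j. P i)" for P and j :: nat
    by (auto simp: less_Suc_eq)
  have loop1: "wp (for_each vCount body1) s1
      (\<lambda>s' t. t \<le> 2 + (6 + 320 * Y) * dec_name (s1 vCount) \<and> Inv1 Atom s')"
    if s1: "Inv1 (s1 vCount) s1" "s1 vInst = s vInst" "s1 vPages = s vPages"
      "s1 vQuery = s vQuery" for s1
  proof (rule wp_for_each)
    fix s2 a v
    assume s2v: "s2 vCount = Cell a v" and inv: "Inv1 (Cell a v) s2"
      and frame: "\<And>y. y \<noteq> vCount \<Longrightarrow> y \<notin> mods body1 \<Longrightarrow> s2 y = s1 y"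
    have q: "s2 vQuery = s vQuery" and ctx2: "ctx I (s2(vElem := v))"
      using s1 ctx frame[of vQuery] frame[of vInst] frame[of vPages]
      by (simp_all add: body1_def ctx_def)
    show "wp body1 s2 (\<lambda>s'' t. t \<le> 320 * Y \<and> Inv1 v (s''(vCount := v)))"
      unfolding body1_def
      apply (intro wp_Seq wp_Assign)
      apply (rule wp_conseq[OF wp_free_prog[OF val, where G = G]])
      using ctx2 inv apply (simp_all add: s2v q G_def Inv1_def width_def)[3]
      apply (rule wp_Cond)
      subgoal using inv Y1 by (intro wp_intros) (auto simp: Inv1_def q s2v ex T_def bad_def Y_def[symmetric])
      subgoal using inv Y1 by (intro wp_intros) (auto simp: Inv1_def q s2v ex T_def bad_def Y_def[symmetric])
      done
  qed (use s1(1) in \<open>auto simp: body1_def\<close>)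
  have loop2: "wp (for_each vCount body2) s1
      (\<lambda>s' t. t \<le> 2 + (6 + 80 * Y) * dec_name (s1 vCount) \<and> Inv2 Atom s')"
    if s1: "Inv2 (s1 vCount) s1" "s1 vQuery = s vQuery" for s1
  proof (rule wp_for_each)
    fix s2 a v
    assume s2v: "s2 vCount = Cell a v" and inv: "Inv2 (Cell a v) s2"
      and frame: "\<And>y. y \<noteq> vCount \<Longrightarrow> y \<notin> mods body2 \<Longrightarrow> s2 y = s1 y"
    have q: "s2 vQuery = s vQuery"
      using s1 frame[of vQuery] by (simp add: body2_def)
    have "{dec_name v..<?n + ?m} = insert (dec_name v) {Suc (dec_name v)..<?n + ?m}"
      using inv by (auto simp: Inv2_def)
    then have card: "card (T \<inter> {dec_name v..<?n + ?m}) =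
        (if dec_name v \<in> T then Suc (card (T \<inter> {Suc (dec_name v)..<?n + ?m}))
         else card (T \<inter> {Suc (dec_name v)..<?n + ?m}))"
      by simp
    show "wp body2 s2 (\<lambda>s'' t. t \<le> 80 * Y \<and> Inv2 v (s''(vCount := v)))"
      unfolding body2_def
      apply (rule wp_Seq)
      apply (rule wp_conseq[OF wp_member_prog[where M = ?M and G = G]])
      using inv apply (simp_all add: s2v q G_def Inv2_def width_def)[4]
      apply (rule wp_Cond)
      subgoal using inv Y1 YG
        by (intro wp_intros)
          (auto simp: Inv2_def q s2v T_def[symmetric] card enc_nat_pow2_Suc simp del: power_Suc)
      subgoal using inv Y1 YG by (intro wp_intros) (auto simp: Inv2_def q s2v T_def[symmetric] card)
      done
  qed (use s1(1) in \<open>auto simp: body2_def\<close>)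
  have b1: "2 + (6 + 320 * Y) * ?n \<le> (8 + 320) * (?M * Y)"
    by (rule loop_bound) (use Y1 in \<open>auto simp: width_def\<close>)
  have b2: "2 + (6 + 80 * Y) * (?n + ?m) \<le> (8 + 80) * (?M * Y)"
    by (rule loop_bound) (use Y1 in \<open>auto simp: width_def\<close>)
  have Y: "1 \<le> ?M * Y" using Y1 by (simp add: width_def)
  have "G \<le> ?M * (1 + dec_name (s vQuery))" by (simp add: G_def width_def)
  then have "?M * Y \<le> ?M * (?M * (?M * (?M * (1 + dec_name (s vQuery)))))"
    unfolding Y_def by (intro mult_le_mono2)
  then have MY: "?M * Y \<le> ?M ^ 4 * (1 + dec_name (s vQuery))"
    by (simp only: power4_eq_xxxx mult.assoc)
  \<comment> \<open>Names of no page do not matter: elements and set pages all lie below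
    \<open>num_elems I + num_sets I\<close>, so the restriction to pages creates or removes no
    conflict.\<close>
  have conf: "conflict I (T \<inter> {..<?n + ?m}) \<longleftrightarrow> (\<exists>x<?n. bad x)"
    using set_page_less[of _ I] by (auto simp: conflict_def bad_def)
  have orc: "feas_oracle (paging_of I) (s vQuery) =
      (if \<exists>x<?n. bad x then enc_nat (2 ^ card (T \<inter> {0..<?n + ?m})) else Atom)"
    by (simp add: feas_oracle_def pages_paging_of flip: T_def)
      (auto simp: paging_of_def conf enc_nat_0 atLeast0LessThan)
  have "wp oracle_prog s
     (\<lambda>s' t. t \<le> 40 + (2 + (6 + 320 * Y) * ?n) + (2 + (6 + 80 * Y) * (?n + ?m)) \<and>
        s' vResult = feas_oracle (paging_of I) (s vQuery))"
    unfolding oracle_prog_def body1_def[symmetric] body2_def[symmetric]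
    apply (intro wp_Seq wp_Assign)
    apply (rule wp_conseq[OF loop1])
    using ctxD[OF ctx] apply (simp_all add: Inv1_def)[4]
    apply (intro wp_Seq wp_Assign)
    apply (rule wp_conseq[OF loop2])
    using ctxD[OF ctx] enc_nat_1 apply (simp_all add: Inv2_def body1_def)[2]
    apply (rule wp_Cond)
    subgoal using ctxD[OF ctx]
      by (intro wp_intros) (auto simp: orc Inv1_def Inv2_def body1_def body2_def)
    subgoal using ctxD[OF ctx]
      by (intro wp_intros) (auto simp: orc Inv1_def Inv2_def body1_def body2_def)
    done
  then show ?thesis
  proof (rule wp_conseq)
    fix s' t
    assume *: "t \<le> 40 + (2 + (6 + 320 * Y) * ?n) + (2 + (6 + 80 * Y) * (?n + ?m)) \<and>
      s' vResult = feas_oracle (paging_of I) (s vQuery)"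
    have "t \<le> 40 + (8 + 320) * (?M * Y) + (8 + 80) * (?M * Y)"
      by (rule order_trans[OF conjunct1[OF *]]) (intro add_mono b1 b2 order_refl)
    moreover have "40 + (8 + 320) * X + (8 + 80) * X \<le> 500 * X" if "1 \<le> X" for X :: nat
      using that by simp
    moreover have "500 * (?M * Y) \<le> 500 * (?M ^ 4 * (1 + dec_name (s vQuery)))"
      using MY by (rule mult_le_mono2)
    ultimately show "t \<le> 500 * (?M ^ 4 * (1 + dec_name (s vQuery))) \<and>
        s' vResult = feas_oracle (paging_of I) (s vQuery)"
      using * Y by (meson order_trans)
  qed
qed

section \<open>Answers and simulation\<close>

text \<open>Register \<open>2 + base\<close> holds the simulated answer. Pages are never removed and
  repetitions are kept, since it only matters whether a page was ever evicted. The list grows by no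
  more than the cells charged for the answers, so searching it stays polynomial.\<close>

definition push_prog :: com where
  "push_prog = Assign vList (EVar (2 + base)) ;;
     for_each vList (Assign vEvicted (ECell (EHd (EVar vList)) (EVar vEvicted)))"

lemma mods_push_prog [simp]: "mods push_prog = {vList, vEvicted}"
  by (auto simp: push_prog_def)

lemma free_push_prog [simp]: "toss_free push_prog" "query_free push_prog"
  by (simp_all add: push_prog_def)

lemma wp_push_prog:
  "wp push_prog s (\<lambda>s' t. t \<le> 20 * (1 + dec_name (s (2 + base))) \<and>
     dec_names (s' vEvicted) = dec_names (s vEvicted) \<union> dec_names (s (2 + base)) \<and>
     dec_name (s' vEvicted) = dec_name (s vEvicted) + dec_name (s (2 + base)))"
proof -
  define body where "body = Assign vEvicted (ECell (EHd (EVar vList)) (EVar vEvicted))"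
  have loop: "wp (for_each vList body) s1
    (\<lambda>s' t. t \<le> 2 + (6 + 5) * dec_name (s1 vList) \<and>
      dec_names (s' vEvicted) \<union> dec_names Atom = dec_names (s1 vEvicted) \<union> dec_names (s1 vList) \<and>
      dec_name (s' vEvicted) + dec_name Atom = dec_name (s1 vEvicted) + dec_name (s1 vList))" for s1
    by (rule wp_for_each[where Inv = "\<lambda>v s'.
      dec_names (s' vEvicted) \<union> dec_names v = dec_names (s1 vEvicted) \<union> dec_names (s1 vList) \<and>
      dec_name (s' vEvicted) + dec_name v = dec_name (s1 vEvicted) + dec_name (s1 vList)"])
     (auto simp: body_def intro!: wp_intros)
  show ?thesis
    unfolding push_prog_def body_def[symmetric]
    by (intro wp_Seq wp_Assign, rule wp_conseq[OF loop]) auto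
qed

text \<open>The last suitable set wins, and 0 is the default if there is none. Either way the answer
  is a small name, which matters because answers are charged with their size.\<close>

definition answer_prog :: com where
  "answer_prog =
     Assign vAns EAtom ;; Assign vIndex EAtom ;;
     Assign vPage (EVar vPages) ;; Assign vSets (ETl (EVar vInst)) ;;
     for_each vSets
       (Assign vPage (ETl (EVar vPage)) ;;
        member_prog (EVar vElem) (ETl (EHd (EVar vSets))) ;;
        Cond (EVar vFound)
          (member_prog (EVar vPage) (EVar vEvicted) ;;
           Cond (EVar vFound) (Assign vAns (EVar vIndex)) Skip)
          Skip ;;
        Assign vIndex (ECell EAtom (EVar vIndex)))"

lemma mods_answer_prog [simp]:
  "mods answer_prog = {vAns, vIndex, vPage, vSets, vKey, vList, vFound, vLeft, vRight}"
  by (auto simp: answer_prog_def)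

lemma free_answer_prog [simp]: "toss_free answer_prog" "query_free answer_prog"
  by (simp_all add: answer_prog_def)

lemma wp_answer_prog:
  assumes val: "valid_setcover I" and ctx: "ctx I s"
    and req: "dec_name (s vElem) < width I"
  defines "ok \<equiv> \<lambda>i. i < num_sets I \<and> dec_name (s vElem) \<in> set_of I i \<and>
     set_page I i \<in> dec_names (s vEvicted)"
  shows "wp answer_prog s
     (\<lambda>s' t. t \<le> 300 * (width I ^ 3 * (1 + dec_name (s vEvicted))) \<and>
        (\<exists>i. s' vAns = enc_name i \<and> i \<le> width I \<and> ((\<exists>i. ok i) \<longrightarrow> ok i)))"
proof -
  let ?M = "width I" and ?n = "num_elems I" and ?m = "num_sets I"
  define G where "G = dec_name (s vEvicted) + ?M"
  define body where "body =
     Assign vPage (ETl (EVar vPage)) ;;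
     member_prog (EVar vElem) (ETl (EHd (EVar vSets))) ;;
     Cond (EVar vFound)
       (member_prog (EVar vPage) (EVar vEvicted) ;;
        Cond (EVar vFound) (Assign vAns (EVar vIndex)) Skip)
       Skip ;;
     Assign vIndex (ECell EAtom (EVar vIndex))"
  define Z where "Z = ?M * G"
  have Z1: "1 \<le> Z" by (simp add: Z_def G_def width_def)
  define Inv where "Inv j s' \<longleftrightarrow> dec_name (s' vPage) = ?n + ?m - j \<and> s' vIndex = enc_name j \<and>
      (\<exists>i. s' vAns = enc_name i \<and> i \<le> ?M \<and> ((\<exists>i<j. ok i) \<longrightarrow> ok i))" for j s'
  have loop: "wp (for_each vSets body) s1
      (\<lambda>s' t. t \<le> 2 + (6 + 150 * Z) * ?m \<and> Inv ?m s')"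
    if s1: "s1 vSets = vtl (s vInst)" "s1 vElem = s vElem" "s1 vEvicted = s vEvicted"
      "Inv 0 s1" for s1
  proof (rule wp_for_each_enc_list)
    show "s1 vSets = enc_list (map (enc_member I) [0..<?m])"
      using s1(1) ctxD[OF ctx] by simp
    show "Inv 0 s1" by fact
    show "vSets \<notin> mods body" by (simp add: body_def)
    fix s2 j
    assume j: "j < ?m" and hd: "vhd (s2 vSets) = enc_member I j" and inv: "Inv j s2"
      and frame: "\<And>y. y \<noteq> vSets \<Longrightarrow> y \<notin> mods body \<Longrightarrow> s2 y = s1 y"
    have s2: "s2 vElem = s vElem" "s2 vEvicted = s vEvicted"
      using frame[of vElem] frame[of vEvicted] s1(2,3) by (simp_all add: body_def)
    have page: "dec_name (s2 vPage) - 1 = set_page I j"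
      using inv j by (simp add: Inv_def set_page_def)
    have less: "set_page I j < ?M" using set_page_less[OF j] by (simp add: width_def)
    note el = enc_member_elems[OF val j]
    from inv obtain i where pg: "dec_name (s2 vPage) = ?n + ?m - j" "s2 vIndex = enc_name j"
      and i: "s2 vAns = enc_name i" "i \<le> ?M" "(\<exists>i<j. ok i) \<longrightarrow> ok i" by (auto simp: Inv_def)
    have okj: "ok j \<longleftrightarrow> dec_name (s vElem) \<in> set_of I j \<and> set_page I j \<in> dec_names (s vEvicted)"
      using j by (simp add: ok_def)
    have jM: "j \<le> ?M" using j by (simp add: width_def)
    have step: "Inv (Suc j) s3"
      if "s3 vPage = vtl (s2 vPage)" "s3 vIndex = Cell Atom (s2 vIndex)"
        "s3 vAns = (if ok j then s2 vIndex else s2 vAns)" for s3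
      using that pg i jM by (auto simp: Inv_def less_Suc_eq split: if_splits)
    show "wp body s2 (\<lambda>s'' t. t \<le> 150 * Z \<and> (\<forall>u. Inv (Suc j) (s''(vSets := u))))"
      unfolding body_def
      apply (intro wp_Seq wp_Assign)
      apply (rule wp_conseq[OF wp_member_prog[where M = ?M and G = G]])
      using req el(2) apply (simp_all add: s2 hd G_def)[4]
      apply (rule wp_Seq, rule wp_Cond)
      apply (rule wp_Seq)
      apply (rule wp_conseq[OF wp_member_prog[where M = ?M and G = G]])
      using page less apply (simp_all add: s2 hd G_def width_def)[4]
      subgoal using Z1 page
        by (intro wp_intros) (auto simp: s2 hd el okj Z_def[symmetric] intro!: step)
      subgoal using Z1 page
        by (intro wp_intros) (auto simp: s2 hd el okj Z_def[symmetric] intro!: step)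
      done
  qed
  have "2 + (6 + 150 * Z) * ?m \<le> (8 + 150) * (?M * Z)"
    by (rule loop_bound) (use Z1 in \<open>auto simp: width_def\<close>)
  moreover have "1 \<le> ?M * Z" using Z1 by (simp add: width_def)
  moreover have "?M * Z \<le> ?M ^ 3 * (1 + dec_name (s vEvicted))"
  proof -
    have "G \<le> ?M * (1 + dec_name (s vEvicted))" by (simp add: G_def width_def)
    then have "?M * Z \<le> ?M * (?M * (?M * (1 + dec_name (s vEvicted))))"
      unfolding Z_def by (intro mult_le_mono2)
    then show ?thesis by (simp only: power3_eq_cube mult.assoc)
  qed
  moreover have "30 + b \<le> 300 * Y"
    if "b \<le> (8 + 150) * X" "1 \<le> X" "X \<le> Y" for b X Y :: nat
    using that by simp
  ultimately have b: "30 + (2 + (6 + 150 * Z) * ?m) \<le>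
      300 * (?M ^ 3 * (1 + dec_name (s vEvicted)))" by blast
  have "wp answer_prog s (\<lambda>s' t. t \<le> 30 + (2 + (6 + 150 * Z) * ?m) \<and> Inv ?m s')"
    unfolding answer_prog_def body_def[symmetric]
    apply (intro wp_Seq wp_Assign)
    apply (rule wp_conseq[OF loop])
    using ctxD[OF ctx] by (auto simp: Inv_def intro!: exI[of _ 0])
  then show ?thesis
    by (rule wp_conseq) (use b in \<open>auto simp: Inv_def ok_def\<close>)
qed

text \<open>The same tree encodes the cost 0 (as the fraction 0/1) and the threshold 2 (bits 0, 1).\<close>

definition setup_prog :: com where
  "setup_prog =
     Assign vResult EAtom ;; Assign vPages (EHd (EVar vInst)) ;; Assign vSets (ETl (EVar vInst)) ;;
     for_each vSets
       (Assign vPages (ECell EAtom (EVar vPages)) ;;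
        Assign vResult (ECell (EHd (EHd (EVar vSets))) (EVar vResult))) ;;
     Assign vCount (EHd (EVar vInst)) ;;
     for_each vCount (Assign vResult (ECell (ECell EAtom (ECell ETrue EAtom)) (EVar vResult))) ;;
     Cond (EVar vPages)
       (Assign base (ECell (ECell EAtom (ECell ETrue EAtom)) (EVar vResult)))
       (Assign base (ECell EAtom (EVar vResult)))"

lemma mods_setup_prog [simp]:
  "mods setup_prog = {vResult, vPages, vSets, vCount, base}"
  by (auto simp: setup_prog_def)

lemma free_setup_prog [simp]: "toss_free setup_prog" "query_free setup_prog"
  by (simp_all add: setup_prog_def)

lemma enc_paging_of:
  "enc_paging (paging_of I) =
     Cell (if num_elems I + num_sets I = 0 then Atom else Cell Atom (Cell (Cell Atom Atom) Atom))
       (enc_list (replicate (num_elems I) (Cell Atom (Cell (Cell Atom Atom) Atom)) @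
          rev (map (\<lambda>j. enc_rat (set_cost I j)) [0..<num_sets I])))"
proof -
  have "enc_rat 0 = Cell Atom (Cell (Cell Atom Atom) Atom)"
    by (simp add: enc_rat_def num_den_0 enc_nat_0 enc_nat_1[simplified])
  moreover have "enc_nat 2 = Cell Atom (Cell (Cell Atom Atom) Atom)"
    using enc_nat_pow2_Suc[of 0] enc_nat_1 by simp
  ultimately show ?thesis
    unfolding enc_paging_def
    by (auto simp: paging_of_def enc_nat_0 nth_append rev_nth add.commute intro!: arg_cong[of _ _ enc_list]
        nth_equalityI)
qed

text \<open>Register \<open>base\<close> is register 0 of the simulated program, where it expects
  its instance.\<close>

lemma wp_setup_prog:
  assumes "s vInst = enc_setcover I"
  shows "wp setup_prog s (\<lambda>s' t. t \<le> 80 * width I \<and>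
     s' vPages = enc_name (num_elems I + num_sets I) \<and> s' base = enc_paging (paging_of I))"
proof -
  let ?n = "num_elems I" and ?m = "num_sets I"
  let ?Z = "Cell Atom (Cell (Cell Atom Atom) Atom)"
  have inst: "vhd (s vInst) = enc_name ?n" "vtl (s vInst) = enc_list (map (enc_member I) [0..<?m])"
    by (simp_all add: assms enc_setcover_alt)
  define body1 where "body1 = Assign vPages (ECell EAtom (EVar vPages)) ;;
        Assign vResult (ECell (EHd (EHd (EVar vSets))) (EVar vResult))"
  define body2 where
    "body2 = Assign vResult (ECell (ECell EAtom (ECell ETrue EAtom)) (EVar vResult))"
  define cs where "cs j = rev (map (\<lambda>j. enc_rat (set_cost I j)) [0..<j])" for j
  have loop1: "wp (for_each vSets body1) s1
      (\<lambda>s' t. t \<le> 2 + (6 + 20) * ?m \<and>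
        s' vPages = enc_name (?n + ?m) \<and> s' vResult = enc_list (cs ?m))"
    if "s1 vSets = vtl (s vInst)" "s1 vPages = enc_name ?n" "s1 vResult = Atom" for s1
    by (rule wp_for_each_enc_list[where g = "enc_member I" and
        Inv = "\<lambda>j s'. s' vPages = enc_name (?n + j) \<and> s' vResult = enc_list (cs j)"])
      (use that inst in \<open>auto simp: body1_def cs_def enc_member_def intro!: wp_intros\<close>)
  have loop2: "wp (for_each vCount body2) s1
      (\<lambda>s' t. t \<le> 2 + (6 + 20) * dec_name (s1 vCount) \<and>
        (\<exists>L. s' vResult = enc_list L \<and>
          replicate (dec_name Atom) ?Z @ L = replicate ?n ?Z @ cs ?m))"
    if "s1 vCount = enc_name ?n" "s1 vResult = enc_list (cs ?m)" for s1
  proof (rule wp_for_each[where Inv = "\<lambda>v s'. \<exists>L. s' vResult = enc_list L \<and>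
          replicate (dec_name v) ?Z @ L = replicate ?n ?Z @ cs ?m"])
    fix s2 a v
    assume "\<exists>L. s2 vResult = enc_list L \<and>
      replicate (dec_name (Cell a v)) ?Z @ L = replicate ?n ?Z @ cs ?m"
    then obtain L where L: "s2 vResult = enc_list L"
      "replicate (dec_name v) ?Z @ (?Z # L) = replicate ?n ?Z @ cs ?m"
      by (auto simp: replicate_app_Cons_same)
    then show "wp body2 s2 (\<lambda>s'' t. t \<le> 20 \<and> (\<exists>L. (s''(vCount := v)) vResult = enc_list L \<and>
        replicate (dec_name v) ?Z @ L = replicate ?n ?Z @ cs ?m))"
      unfolding body2_def by (intro wp_intros) (auto intro!: exI[of _ "?Z # L"])
  qed (use that in \<open>auto simp: body2_def\<close>)
  show ?thesis
    unfolding setup_prog_def body1_def[symmetric] body2_def[symmetric]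
    apply (intro wp_Seq wp_Assign)
    apply (rule wp_conseq[OF loop1])
    using inst apply (simp_all)[3]
    apply (intro wp_Seq wp_Assign)
    apply (rule wp_conseq[OF loop2])
    using inst apply (simp_all add: body1_def)[2]
    apply (rule wp_Cond)
    subgoal using inst
      by (intro wp_intros)
        (auto simp: body1_def body2_def enc_paging_of cs_def width_def eq_Atom_iff)
    subgoal using inst
      by (intro wp_intros)
        (auto simp: body1_def body2_def enc_paging_of cs_def width_def eq_Atom_iff)
    done
qed

section \<open>Simulation of the paging program\<close>

fun shift :: "expr \<Rightarrow> expr" where
  "shift EAtom = EAtom"
| "shift (EVar x) = EVar (x + base)"
| "shift (EHd e) = EHd (shift e)"
| "shift (ETl e) = ETl (shift e)"
| "shift (ECell d e) = ECell (shift d) (shift e)"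

fun simulate :: "com \<Rightarrow> com" where
  "simulate Skip = Skip"
| "simulate (Assign x e) = Assign (x + base) (shift e)"
| "simulate (Seq c d) = Seq (simulate c) (simulate d)"
| "simulate (Cond e c d) = Cond (shift e) (simulate c) (simulate d)"
| "simulate (While e c) = While (shift e) (simulate c)"
| "simulate (Toss x) = Toss (x + base)"
| "simulate (Query x e) =
     Assign vQuery (shift e) ;; oracle_prog ;; Assign (x + base) (EVar vResult)"

lemma ops_shift [simp]: "ops (shift e) = ops e"
  by (induction e) auto

lemma eval_shift: "(\<And>x. \<sigma> (x + base) = s x) \<Longrightarrow> eval (shift e) \<sigma> = eval e s"
  by (induction e) auto

lemma query_free_simulate [simp]: "query_free (simulate c)"
  and toss_free_simulate [simp]: "toss_free c \<Longrightarrow> toss_free (simulate c)"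
  by (induction c) auto

text \<open>Hence the instance, the list of evicted pages and the registers of the loading loop
  survive every simulated command.\<close>

lemma mods_simulate: "y \<in> mods (simulate c) \<Longrightarrow> y \<ge> base \<or> y = vQuery \<or> y \<in> mods oracle_prog"
  by (induction c) auto

definition represents :: "setcover \<Rightarrow> store \<Rightarrow> store \<Rightarrow> bool" where
  "represents I \<sigma> s \<longleftrightarrow> ctx I \<sigma> \<and> (\<forall>x. \<sigma> (x + base) = s x)"

text \<open>Commands other than \<open>Query\<close> are copied one for one; the factor is needed
  for queries, where \<open>cells a\<close> bounds the length of the query. Both runs leave the same
  tosses \<open>w'\<close>, so they stay synchronized. Diverging runs can be left out, as their time
  is infinite.\<close>

lemma big_step_simulate:
  assumes "big_step (feas_oracle (paging_of I)) c s w s' w' t"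
    and val: "valid_setcover I"
    and "represents I \<sigma> s"
  shows "\<exists>\<sigma>' t'. big_step (\<lambda>_. Atom) (simulate c) \<sigma> w \<sigma>' w' t' \<and> represents I \<sigma>' s' \<and>
    t' \<le> 520 * width I ^ 4 * t"
  using assms(1,3)
proof (induction arbitrary: \<sigma> rule: big_step.induct)
  let ?P = "520 * width I ^ 4"
  have P: "1 \<le> ?P" by (simp add: width_def)
  have P': "k \<le> ?P * k" for k using P by (cases "?P") auto
  note ev = eval_shift[of \<sigma> s for \<sigma> s]
  {
    case (Skip s w)
    then show ?case using P big_step.Skip by (metis simulate.simps(1) mult.right_neutral)
  next
    case (Assign x e s w)
    then have "eval (shift e) \<sigma> = eval e s" by (intro ev) (simp add: represents_def)
    with Assign have "represents I (\<sigma>(x + base := eval (shift e) \<sigma>)) (s(x := eval e s))"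
      by (auto simp: represents_def ctx_def)
    then show ?case
      using big_step.Assign[of "\<lambda>_. Atom" "x + base" "shift e" \<sigma> w] P'[of "1 + ops e"]
      by (metis simulate.simps(2) ops_shift)
  next
    case (Seq c s w s' w' t d s'' w'' u)
    from Seq.IH(1)[OF Seq.prems] obtain \<sigma>1 t1 where
      1: "big_step (\<lambda>_. Atom) (simulate c) \<sigma> w \<sigma>1 w' t1" "represents I \<sigma>1 s'" "t1 \<le> ?P * t"
      by blast
    from Seq.IH(2)[OF 1(2)] obtain \<sigma>2 t2 where
      2: "big_step (\<lambda>_. Atom) (simulate d) \<sigma>1 w' \<sigma>2 w'' t2" "represents I \<sigma>2 s''" "t2 \<le> ?P * u"
      by blast
    have "1 + t1 + t2 \<le> ?P * (1 + t + u)" using 1(3) 2(3) P by (simp add: distrib_left)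
    with big_step.Seq[OF 1(1) 2(1)] 2(2) show ?case by auto
  next
    case (CondT e s c w s' w' t d)
    then have e: "eval (shift e) \<sigma> = eval e s" by (intro ev) (simp add: represents_def)
    from CondT.IH[OF CondT.prems] obtain \<sigma>1 t1 where
      1: "big_step (\<lambda>_. Atom) (simulate c) \<sigma> w \<sigma>1 w' t1" "represents I \<sigma>1 s'" "t1 \<le> ?P * t"
      by blast
    have "1 + ops (shift e) + t1 \<le> ?P * (1 + ops e + t)"
      using 1(3) P'[of "1 + ops e"] by (simp add: distrib_left)
    with big_step.CondT[OF _ 1(1), of "shift e" "simulate d"] 1(2) CondT.hyps(1) e
    show ?case by auto
  next
    case (CondF e s d w s' w' t c)
    then have e: "eval (shift e) \<sigma> = eval e s" by (intro ev) (simp add: represents_def)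
    from CondF.IH[OF CondF.prems] obtain \<sigma>1 t1 where
      1: "big_step (\<lambda>_. Atom) (simulate d) \<sigma> w \<sigma>1 w' t1" "represents I \<sigma>1 s'" "t1 \<le> ?P * t"
      by blast
    have "1 + ops (shift e) + t1 \<le> ?P * (1 + ops e + t)"
      using 1(3) P'[of "1 + ops e"] by (simp add: distrib_left)
    with big_step.CondF[OF _ 1(1), of "shift e" "simulate c"] 1(2) CondF.hyps(1) e
    show ?case by auto
  next
    case (WhileF e s c w)
    then have e: "eval (shift e) \<sigma> = eval e s" by (intro ev) (simp add: represents_def)
    with big_step.WhileF[of "shift e" \<sigma> "\<lambda>_. Atom" "simulate c" w] WhileF P'[of "1 + ops e"]
    show ?case by (metis simulate.simps(5) ops_shift)
  next
    case (WhileT e s c w s' w' t s'' w'' u)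
    then have e: "eval (shift e) \<sigma> = eval e s" by (intro ev) (simp add: represents_def)
    from WhileT.IH(1)[OF WhileT.prems] obtain \<sigma>1 t1 where
      1: "big_step (\<lambda>_. Atom) (simulate c) \<sigma> w \<sigma>1 w' t1" "represents I \<sigma>1 s'" "t1 \<le> ?P * t"
      by blast
    from WhileT.IH(2)[OF 1(2)] obtain \<sigma>2 t2 where
      2: "big_step (\<lambda>_. Atom) (While (shift e) (simulate c)) \<sigma>1 w' \<sigma>2 w'' t2"
        "represents I \<sigma>2 s''" "t2 \<le> ?P * u"
      by auto
    have "1 + ops (shift e) + t1 + t2 \<le> ?P * (1 + ops e + t + u)"
      using 1(3) 2(3) P'[of "1 + ops e"] by (simp add: distrib_left)
    with big_step.WhileT[OF _ 1(1) 2(1)] 2(2) WhileT.hyps(1) e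
    show ?case by auto
  next
    case (Toss x s w)
    then have "represents I (\<sigma>(x + base := enc_bool (shd w))) (s(x := enc_bool (shd w)))"
      by (auto simp: represents_def ctx_def)
    then show ?case
      using big_step.Toss[of "\<lambda>_. Atom" "x + base" \<sigma> w] P
      by (metis simulate.simps(6) mult.right_neutral)
  next
    case (Query a e s x w)
    let ?orc = "feas_oracle (paging_of I)"
    have e: "eval (shift e) \<sigma> = a"
      using Query ev[of \<sigma> s e] by (simp add: represents_def)
    let ?\<sigma>1 = "\<sigma>(vQuery := a)"
    have "ctx I ?\<sigma>1" using Query by (simp add: represents_def ctx_def)
    from wp_oracle_prog[OF val this] obtain \<sigma>2 t2 where
      2: "big_step (\<lambda>_. Atom) oracle_prog ?\<sigma>1 w \<sigma>2 w t2"
        "t2 \<le> 500 * (width I ^ 4 * (1 + dec_name a))" "\<sigma>2 vResult = ?orc a"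
      unfolding wp_def by auto
    have frame: "\<sigma>2 y = \<sigma> y" if "y \<notin> insert vQuery (mods oracle_prog)" for y
      using big_step_frame[OF 2(1)] that by simp
    let ?\<sigma>3 = "\<sigma>2(x + base := ?orc a)"
    have "big_step (\<lambda>_. Atom) (simulate (Query x e)) \<sigma> w ?\<sigma>3 w
        (1 + (1 + ops (shift e)) + (1 + t2 + (1 + ops (EVar vResult))))"
      unfolding simulate.simps
      using big_step.Assign[of _ vQuery "shift e" \<sigma> w]
        big_step.Assign[of _ "x + base" "EVar vResult" \<sigma>2 w] 2(1,3) e
      by (intro big_step.Seq) auto
    moreover have "represents I ?\<sigma>3 (s(x := ?orc a))"
      using Query frame by (auto simp: represents_def ctx_def)
    moreover have "1 + (1 + ops (shift e)) + (1 + t2 + (1 + ops (EVar vResult))) \<le>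
        ?P * (1 + ops e + cells a + cells (?orc a))"
    proof -
      let ?W = "width I ^ 4"
      have W: "1 \<le> ?W" by (simp add: width_def)
      have "?W * (1 + dec_name a) \<le> ?W * (1 + ops e + cells a + cells (?orc a))"
        by (intro mult_le_mono2) (use dec_name_le_cells[of a] in simp)
      moreover have "1 + ops e + cells a + cells (?orc a) \<le>
          ?W * (1 + ops e + cells a + cells (?orc a))" using W by (cases ?W) auto
      ultimately show ?thesis using 2(2) by (simp only: ops_shift ops.simps mult.assoc)
    qed
    ultimately show ?case by blast
  }
qed

section \<open>The set cover algorithm\<close>

lemma exec_eq_Some_iff: "exec orc c s w = Some (s', w', t) \<longleftrightarrow> big_step orc c s w s' w' t"
proof -
  have "(THE (s', w', t). big_step orc c s w s' w' t) = (s1, w1, t1)"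
    if "big_step orc c s w s1 w1 t1" for s1 w1 t1
  proof (rule the_equality)
    show "p = (s1, w1, t1)" if "case p of (s', w', t) \<Rightarrow> big_step orc c s w s' w' t" for p
    proof -
      obtain s2 w2 t2 where p: "p = (s2, w2, t2)" by (cases p)
      with that have "big_step orc c s w s2 w2 t2" by simp
      from big_step_deterministic[OF this \<open>big_step orc c s w s1 w1 t1\<close>] p show ?thesis by simp
    qed
  qed (use that in simp)
  then have exec: "exec orc c s w = Some (s1, w1, t1)"
    if "big_step orc c s w s1 w1 t1" for s1 w1 t1
    using that unfolding exec_def by auto
  show ?thesis
  proof
    assume "exec orc c s w = Some (s', w', t)"
    moreover from this obtain s1 w1 t1 where "big_step orc c s w s1 w1 t1"
      by (auto simp: exec_def split: if_splits)
    ultimately show "big_step orc c s w s' w' t" using exec by auto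
  qed (rule exec)
qed

lemma serve_Cons_iff:
  "serve orc c s w (r # rs) = Some (vs, u) \<longleftrightarrow>
     (\<exists>s' w' t vs' u'. big_step orc c (s(1 := enc_name r)) w s' w' t \<and>
        serve orc c s' w' rs = Some (vs', u') \<and> vs = s' 2 # vs' \<and> u = t + cells (s' 2) + u')"
  by (auto simp flip: exec_eq_Some_iff split: option.splits prod.splits)

lemma run_eq_Some_iff:
  "run orc A v rs w = Some (vs, u) \<longleftrightarrow>
     (\<exists>s' w' t u'. big_step orc (init A) ((\<lambda>_. Atom)(0 := v)) w s' w' t \<and>
        serve orc (step A) s' w' rs = Some (vs, u') \<and> u = t + u')"
  by (auto simp: run_def simp flip: exec_eq_Some_iff split: option.splits prod.splits)

text \<open>\<open>vNext\<close> runs downwards through the set pages, while \<open>vTodo\<close>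
  merely counts the sets. Both are kept apart from the work registers of \<open>oracle_prog\<close>,
  which simulated queries overwrite.\<close>

definition load_body :: "online_alg \<Rightarrow> com" where
  "load_body A = Assign vNext (ETl (EVar vNext)) ;; Assign (1 + base) (EVar vNext) ;;
     simulate (step A) ;; push_prog"

text \<open>The requests to sets do not depend on the elements to come, so all of them are simulated
  in \<open>init\<close>; afterwards each element costs one simulated request, which keeps the
  algorithm online. \<open>vElem\<close> is loaded after the simulated step because
  \<open>oracle_prog\<close> overwrites it.\<close>

definition setcover_alg :: "online_alg \<Rightarrow> online_alg" where
  "setcover_alg A =
     \<lparr>init = setup_prog ;; simulate (init A) ;;
        Assign vNext (EVar vPages) ;; Assign vTodo (ETl (EVar vInst)) ;;
        for_each vTodo (load_body A),
      step = Assign (1 + base) (EVar vReq) ;; (simulate (step A) ;; push_prog) ;;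
        Assign vElem (EVar vReq) ;; answer_prog\<rparr>"

lemma representsD:
  assumes "represents I \<sigma> s"
  shows "ctx I \<sigma>" and "\<sigma> (x + base) = s x"
  using assms by (auto simp: represents_def)

text \<open>The common part of loading and of serving elements. As \<open>1 \<le> t\<close>, the
  overhead and the traversal of the answer raise the factor 520 by only 30.\<close>

lemma big_step_simulate_push:
  assumes run: "big_step (feas_oracle (paging_of I)) c s w s' w' t"
    and val: "valid_setcover I" and rep: "represents I \<sigma> s"
  shows "\<exists>\<sigma>' t'. big_step (\<lambda>_. Atom) (simulate c ;; push_prog) \<sigma> w \<sigma>' w' t' \<and>
    represents I \<sigma>' s' \<and>
    dec_names (\<sigma>' vEvicted) = dec_names (\<sigma> vEvicted) \<union> dec_names (s' 2) \<and>
    dec_name (\<sigma>' vEvicted) = dec_name (\<sigma> vEvicted) + dec_name (s' 2) \<and>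
    (\<forall>y\<in>{vReq, vTodo, vNext}. \<sigma>' y = \<sigma> y) \<and>
    t' \<le> 550 * (width I ^ 4 * (t + cells (s' 2)))"
proof -
  define W where "W = width I ^ 4"
  have W: "1 \<le> W" by (simp add: W_def width_def)
  then have W_le: "k \<le> W * k" for k by (cases W) auto
  from big_step_simulate[OF run val rep] obtain \<sigma>1 t1 where
    1: "big_step (\<lambda>_. Atom) (simulate c) \<sigma> w \<sigma>1 w' t1" "represents I \<sigma>1 s'" "t1 \<le> 520 * W * t"
    by (auto simp: W_def)
  from wp_push_prog[of \<sigma>1] obtain \<sigma>2 t2 where
    2: "big_step (\<lambda>_. Atom) push_prog \<sigma>1 w' \<sigma>2 w' t2" "t2 \<le> 20 * (1 + dec_name (s' 2))"
      "dec_names (\<sigma>2 vEvicted) = dec_names (\<sigma>1 vEvicted) \<union> dec_names (s' 2)"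
      "dec_name (\<sigma>2 vEvicted) = dec_name (\<sigma>1 vEvicted) + dec_name (s' 2)"
    using representsD(2)[OF 1(2), of 2] unfolding wp_def by auto
  have f1: "\<sigma>1 y = \<sigma> y" if "y \<in> {vEvicted, vReq, vTodo, vNext}" for y
    by (rule big_step_frame[OF 1(1)]) (use that mods_simulate[of y c] in auto)
  have f2: "\<sigma>2 y = \<sigma>1 y" if "y \<noteq> vList" "y \<noteq> vEvicted" for y
    using big_step_frame[OF 2(1)] that by simp
  have "represents I \<sigma>2 s'" using 1(2) f2 by (auto simp: represents_def ctx_def)
  moreover have "1 + t1 + t2 \<le> 550 * (W * (t + cells (s' 2)))"
  proof -
    have "1 \<le> t" using run by (rule big_step_time_pos)
    then have "21 + 20 * cells (s' 2) \<le> 30 * (t + cells (s' 2))" by simp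
    also have "\<dots> \<le> 30 * (W * (t + cells (s' 2)))" by (intro mult_le_mono2 W_le)
    finally have "21 + 20 * cells (s' 2) \<le> 30 * (W * t) + 30 * (W * cells (s' 2))"
      by (simp add: distrib_left)
    then show ?thesis
      using 1(3) 2(2) dec_name_le_cells[of "s' 2"] by (simp add: distrib_left)
  qed
  ultimately show ?thesis
    using big_step.Seq[OF 1(1) 2(1)] 2(3,4) f1 f2 unfolding W_def
    by (intro exI[of _ \<sigma>2] exI[of _ "1 + t1 + t2"]) simp
qed

text \<open>The paging run is cut at its first element request. Since \<open>u1\<close> includes the
  charge for answers, it bounds the growth of the list that serving has to search.\<close>

lemma load_pages:
  assumes val: "valid_setcover I"
    and "serve (feas_oracle (paging_of I)) (step A) s w
      (map (set_page I) [j..<num_sets I] @ xs) = Some (vs, u)"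
    and "represents I \<sigma> s" and "j \<le> num_sets I"
    and "\<sigma> vTodo = enc_list (map (enc_member I) [j..<num_sets I])"
    and "\<sigma> vNext = enc_name (num_elems I + num_sets I - j)"
  shows "\<exists>\<sigma>' s' w' vs1 vs2 u1 u2 t'.
    big_step (\<lambda>_. Atom) (for_each vTodo (load_body A)) \<sigma> w \<sigma>' w' t' \<and> represents I \<sigma>' s' \<and>
    serve (feas_oracle (paging_of I)) (step A) s' w' xs = Some (vs2, u2) \<and>
    vs = vs1 @ vs2 \<and> u = u1 + u2 \<and> length vs1 = num_sets I - j \<and>
    dec_names (\<sigma>' vEvicted) = dec_names (\<sigma> vEvicted) \<union> \<Union> (dec_names ` set vs1) \<and>
    dec_name (\<sigma>' vEvicted) \<le> dec_name (\<sigma> vEvicted) + u1 \<and>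
    t' \<le> 2 + 600 * (width I ^ 4 * u1)"
  using assms(2-)
proof (induction "num_sets I - j" arbitrary: j s w vs u \<sigma>)
  case 0
  then have "j = num_sets I" by simp
  with 0 show ?case
    using for_each_Atom[of \<sigma> vTodo "\<lambda>_. Atom" "load_body A" w]
    by (intro exI[of _ \<sigma>] exI[of _ s] exI[of _ w] exI[of _ "[]"] exI[of _ vs] exI[of _ 0]
        exI[of _ u] exI[of _ 2]) auto
next
  case (Suc k)
  let ?orc = "feas_oracle (paging_of I)" and ?m = "num_sets I"
  define W where "W = width I ^ 4"
  have W: "1 \<le> W" by (simp add: W_def width_def)
  then have W_le: "k \<le> W * k" for k by (cases W) auto
  from Suc.hyps(2) have j: "j < ?m" by simp
  then have upt: "[j..<?m] = j # [Suc j..<?m]" by (rule upt_conv_Cons)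
  from Suc.prems(1) obtain s1 w1 t1 vs' u' where
    s1: "big_step ?orc (step A) (s(1 := enc_name (set_page I j))) w s1 w1 t1"
    and rest: "serve ?orc (step A) s1 w1 (map (set_page I) [Suc j..<?m] @ xs) = Some (vs', u')"
    and vs: "vs = s1 2 # vs'" and u: "u = t1 + cells (s1 2) + u'"
    by (auto simp: upt serve_Cons_iff simp del: serve.simps)
  have page: "num_elems I + ?m - j = Suc (set_page I j)"
    using j by (simp add: set_page_def)
  let ?\<sigma>1 = "\<sigma>(vNext := enc_name (set_page I j))"
  let ?\<sigma>2 = "?\<sigma>1(1 + base := enc_name (set_page I j))"
  have a1: "big_step (\<lambda>_. Atom) (Assign vNext (ETl (EVar vNext))) \<sigma> w ?\<sigma>1 w 3"
    using big_step.Assign[of "\<lambda>_. Atom" vNext "ETl (EVar vNext)" \<sigma> w] Suc.prems(5) page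
    by (simp add: numeral_3_eq_3)
  have a2: "big_step (\<lambda>_. Atom) (Assign (1 + base) (EVar vNext)) ?\<sigma>1 w ?\<sigma>2 w 2"
    using big_step.Assign[of "\<lambda>_. Atom" "1 + base" "EVar vNext" ?\<sigma>1 w]
    by (simp add: numeral_2_eq_2)
  have "represents I ?\<sigma>2 (s(1 := enc_name (set_page I j)))"
    using Suc.prems(2) by (auto simp: represents_def ctx_def)
  from big_step_simulate_push[OF s1 val this] obtain \<sigma>3 t3 where
    a3: "big_step (\<lambda>_. Atom) (simulate (step A) ;; push_prog) ?\<sigma>2 w \<sigma>3 w1 t3"
    and rep3: "represents I \<sigma>3 s1"
    and ev3: "dec_names (\<sigma>3 vEvicted) = dec_names (\<sigma> vEvicted) \<union> dec_names (s1 2)"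
      "dec_name (\<sigma>3 vEvicted) = dec_name (\<sigma> vEvicted) + dec_name (s1 2)"
    and keep: "\<sigma>3 vTodo = \<sigma> vTodo" "\<sigma>3 vNext = enc_name (set_page I j)"
    and t3: "t3 \<le> 550 * (W * (t1 + cells (s1 2)))"
    by (auto simp: W_def)
  let ?\<sigma>4 = "\<sigma>3(vTodo := enc_list (map (enc_member I) [Suc j..<?m]))"
  have rep4: "represents I ?\<sigma>4 s1"
    using rep3 by (auto simp: represents_def ctx_def)
  have next4: "?\<sigma>4 vNext = enc_name (num_elems I + ?m - Suc j)"
    using keep(2) j by (simp add: set_page_def)
  have k: "k = ?m - Suc j" using Suc.hyps(2) by simp
  have todo4: "?\<sigma>4 vTodo = enc_list (map (enc_member I) [Suc j..<?m])"
    and evicted4: "?\<sigma>4 vEvicted = \<sigma>3 vEvicted" by simp_all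
  from Suc.hyps(1)[OF k rest rep4 Suc_leI[OF j] todo4 next4, folded W_def, unfolded evicted4]
  obtain \<sigma>' s' w' vs1 vs2 u1 u2 t' where
    IH: "big_step (\<lambda>_. Atom) (for_each vTodo (load_body A)) ?\<sigma>4 w1 \<sigma>' w' t'" "represents I \<sigma>' s'"
      "serve ?orc (step A) s' w' xs = Some (vs2, u2)"
      "vs' = vs1 @ vs2" "u' = u1 + u2" "length vs1 = ?m - Suc j"
      "dec_names (\<sigma>' vEvicted) = dec_names (\<sigma>3 vEvicted) \<union> \<Union> (dec_names ` set vs1)"
      "dec_name (\<sigma>' vEvicted) \<le> dec_name (\<sigma>3 vEvicted) + u1"
      "t' \<le> 2 + 600 * (W * u1)"
    by (elim exE conjE) (rule that)
  have body: "big_step (\<lambda>_. Atom) (load_body A) \<sigma> w \<sigma>3 w1 (1 + 3 + (1 + 2 + t3))"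
    unfolding load_body_def by (rule big_step.Seq[OF a1 big_step.Seq[OF a2 a3]])
  have "\<sigma> vTodo = Cell (enc_member I j) (enc_list (map (enc_member I) [Suc j..<?m]))"
    using Suc.prems(4) by (simp add: upt)
  from for_each_Cell[OF this body keep(1) IH(1)]
  have "big_step (\<lambda>_. Atom) (for_each vTodo (load_body A)) \<sigma> w \<sigma>' w' (13 + t3 + t')"
    by simp
  moreover have "13 + t3 + t' \<le> 2 + 600 * (W * (t1 + cells (s1 2) + u1))"
  proof -
    have "1 \<le> t1" using s1 by (rule big_step_time_pos)
    then have "13 \<le> 50 * (t1 + cells (s1 2))" by simp
    also have "\<dots> \<le> 50 * (W * (t1 + cells (s1 2)))" by (intro mult_le_mono2 W_le)
    finally have "13 \<le> 50 * (W * t1) + 50 * (W * cells (s1 2))" by (simp add: distrib_left)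
    then show ?thesis using t3 IH(9) by (simp add: distrib_left)
  qed
  moreover have "vs = (s1 2 # vs1) @ vs2" using vs IH(4) by simp
  moreover have "u = (t1 + cells (s1 2) + u1) + u2" using u IH(5) by simp
  moreover have "length (s1 2 # vs1) = ?m - j" using IH(6) j by simp
  moreover have "dec_names (\<sigma>' vEvicted) =
      dec_names (\<sigma> vEvicted) \<union> \<Union> (dec_names ` set (s1 2 # vs1))"
    using IH(7) ev3(1) by (simp add: Un_assoc)
  moreover have "dec_name (\<sigma>' vEvicted) \<le> dec_name (\<sigma> vEvicted) + (t1 + cells (s1 2) + u1)"
    using IH(8) ev3(2) dec_name_le_cells[of "s1 2"] by simp
  ultimately show ?case using IH(2,3) unfolding W_def by (intro exI conjI)
qed

text \<open>Every request searches the whole list of evicted pages again, whose length never exceeds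
  \<open>dec_name (\<sigma> vEvicted) + u\<close>; this is why the bound has the factor
  \<open>length xs\<close>.\<close>

lemma serve_elements:
  assumes val: "valid_setcover I"
    and "serve (feas_oracle (paging_of I)) (step A) s w xs = Some (vs, u)"
    and "represents I \<sigma> s" and "set xs \<subseteq> {..<num_elems I}"
  shows "\<exists>vs' u'. serve (\<lambda>_. Atom) (step (setcover_alg A)) \<sigma> w xs = Some (vs', u') \<and>
    follows I (dec_names (\<sigma> vEvicted)) xs (map dec_names vs) (map dec_name vs') \<and>
    u' \<le> length xs * (1000 * (width I ^ 4 * (1 + dec_name (\<sigma> vEvicted) + u)))"
  using assms(2-)
proof (induction xs arbitrary: s w vs u \<sigma>)
  case Nil
  then show ?case by auto
next
  case (Cons x xs)
  let ?orc = "feas_oracle (paging_of I)" and ?E = "dec_name (\<sigma> vEvicted)"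
  define W where "W = width I ^ 4"
  have W: "1 \<le> W" by (simp add: W_def width_def)
  from Cons.prems(1) obtain s1 w1 t1 vs' u' where
    s1: "big_step ?orc (step A) (s(1 := enc_name x)) w s1 w1 t1"
    and rest: "serve ?orc (step A) s1 w1 xs = Some (vs', u')"
    and vs: "vs = s1 2 # vs'" and u: "u = t1 + cells (s1 2) + u'"
    by (auto simp: serve_Cons_iff simp del: serve.simps)
  let ?\<sigma>0 = "\<sigma>(1 := enc_name x)"
  let ?\<sigma>1 = "?\<sigma>0(1 + base := enc_name x)"
  have a1: "big_step (\<lambda>_. Atom) (Assign (1 + base) (EVar vReq)) ?\<sigma>0 w ?\<sigma>1 w 2"
    using big_step.Assign[of "\<lambda>_. Atom" "1 + base" "EVar vReq" ?\<sigma>0 w]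
    by (simp add: numeral_2_eq_2)
  have "represents I ?\<sigma>1 (s(1 := enc_name x))"
    using Cons.prems(2) by (auto simp: represents_def ctx_def)
  from big_step_simulate_push[OF s1 val this] obtain \<sigma>2 t2 where
    a2: "big_step (\<lambda>_. Atom) (simulate (step A) ;; push_prog) ?\<sigma>1 w \<sigma>2 w1 t2"
    and rep2: "represents I \<sigma>2 s1"
    and ev2: "dec_names (\<sigma>2 vEvicted) = dec_names (\<sigma> vEvicted) \<union> dec_names (s1 2)"
      "dec_name (\<sigma>2 vEvicted) = ?E + dec_name (s1 2)"
    and req: "\<sigma>2 vReq = enc_name x"
    and t2: "t2 \<le> 550 * (W * (t1 + cells (s1 2)))"
    by (auto simp: W_def)
  let ?\<sigma>3 = "\<sigma>2(vElem := enc_name x)"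
  have a3: "big_step (\<lambda>_. Atom) (Assign vElem (EVar vReq)) \<sigma>2 w1 ?\<sigma>3 w1 2"
    using big_step.Assign[of "\<lambda>_. Atom" vElem "EVar vReq" \<sigma>2 w1] req
    by (simp add: numeral_2_eq_2)
  have "ctx I ?\<sigma>3" using rep2 by (auto simp: represents_def ctx_def)
  moreover have "dec_name (?\<sigma>3 vElem) < width I" using Cons.prems(3) by (simp add: width_def)
  ultimately obtain \<sigma>4 t4 i where
    a4: "big_step (\<lambda>_. Atom) answer_prog ?\<sigma>3 w1 \<sigma>4 w1 t4"
    and t4: "t4 \<le> 300 * (width I ^ 3 * (1 + dec_name (?\<sigma>3 vEvicted)))"
    and ans: "\<sigma>4 vAns = enc_name i" "i \<le> width I"
    and i: "(\<exists>j<num_sets I. x \<in> set_of I j \<and> set_page I j \<in> dec_names (\<sigma>2 vEvicted)) \<Longrightarrow>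
      i < num_sets I \<and> x \<in> set_of I i \<and> set_page I i \<in> dec_names (\<sigma>2 vEvicted)"
    using wp_answer_prog[OF val, of ?\<sigma>3] unfolding wp_def by auto
  have f4: "\<sigma>4 y = \<sigma>2 y" if "y \<notin> mods answer_prog" "y \<noteq> vElem" for y
    using big_step_frame[OF a4 that(1)] that(2) by simp
  have rep4: "represents I \<sigma>4 s1" and ev4: "\<sigma>4 vEvicted = \<sigma>2 vEvicted"
    using rep2 f4 by (auto simp: represents_def ctx_def)
  from Cons.IH[OF rest rep4] Cons.prems(3) obtain js u4 where
    IH: "serve (\<lambda>_. Atom) (step (setcover_alg A)) \<sigma>4 w1 xs = Some (js, u4)"
      "follows I (dec_names (\<sigma>2 vEvicted)) xs (map dec_names vs') (map dec_name js)"
      "u4 \<le> length xs * (1000 * (W * (1 + dec_name (\<sigma>2 vEvicted) + u')))"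
    by (auto simp: ev4 W_def)
  have "big_step (\<lambda>_. Atom) (step (setcover_alg A)) ?\<sigma>0 w \<sigma>4 w1
      (1 + 2 + (1 + t2 + (1 + 2 + t4)))"
    unfolding setcover_alg_def online_alg.simps
    by (rule big_step.Seq[OF a1 big_step.Seq[OF a2 big_step.Seq[OF a3 a4]]])
  then have "serve (\<lambda>_. Atom) (step (setcover_alg A)) \<sigma> w (x # xs) =
      Some (\<sigma>4 2 # js, (1 + 2 + (1 + t2 + (1 + 2 + t4))) + cells (\<sigma>4 2) + u4)"
    using IH(1) unfolding serve_Cons_iff by blast
  moreover have "follows I (dec_names (\<sigma> vEvicted)) (x # xs) (map dec_names vs)
      (map dec_name (\<sigma>4 2 # js))"
    using IH(2) i by (simp add: vs ans ev2(1))
  moreover have "(1 + 2 + (1 + t2 + (1 + 2 + t4))) + cells (\<sigma>4 2) + u4 \<le>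
      length (x # xs) * (1000 * (W * (1 + ?E + u)))"
  proof -
    let ?X = "W * (1 + ?E + u)"
    have arith: "(1 + 2 + (1 + a + (1 + 2 + b))) + c + d \<le> length (x # xs) * (1000 * X)"
      if "d \<le> length xs * (1000 * X)" "a \<le> 550 * X" "b \<le> 300 * X" "c \<le> X" "1 \<le> X"
      for a b c d X
      using that by (simp add: algebra_simps)
    have "u4 \<le> length xs * (1000 * ?X)"
      by (rule order_trans[OF IH(3)], intro mult_le_mono2)
        (use ev2(2) u dec_name_le_cells[of "s1 2"] in simp)
    moreover have "t2 \<le> 550 * ?X"
      by (rule order_trans[OF t2], intro mult_le_mono2) (simp add: u)
    moreover have "t4 \<le> 300 * ?X"
    proof (rule order_trans[OF t4], intro mult_le_mono mult_le_mono2)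
      show "width I ^ 3 \<le> W" unfolding W_def by (rule power_increasing) (auto simp: width_def)
    qed (use ev2(2) u dec_name_le_cells[of "s1 2"] in simp_all)
    moreover have "width I ^ 1 \<le> W" unfolding W_def
      by (rule power_increasing) (auto simp: width_def)
    then have "cells (\<sigma>4 2) \<le> ?X" using ans by simp
    moreover have "1 \<le> ?X" using W by simp
    ultimately show ?thesis by (rule arith)
  qed
  ultimately show ?case by (auto simp: W_def)
qed

text \<open>In the fifth power, four factors bound \<open>width I ^ 4\<close> and one bounds the
  number of element requests plus one.\<close>

lemma setcover_run_simulates:
  assumes inp: "setcover_input I xs"
    and run: "paging_run A (paging_of I) (page_requests I @ xs) w = Some (vs, t)"
  shows "\<exists>js t' vs1 vs2. setcover_run (setcover_alg A) I xs w = Some (js, t') \<and>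
    t' \<le> 1000 * (setcover_size I xs + 1) ^ 5 * t \<and> vs = vs1 @ vs2 \<and> length vs1 = num_sets I \<and>
    follows I (\<Union> (dec_names ` set vs1)) xs (map dec_names vs2) (map dec_name js)"
proof -
  let ?orc = "feas_oracle (paging_of I)" and ?m = "num_sets I"
  define W where "W = width I ^ 4"
  have W: "1 \<le> W" by (simp add: W_def width_def)
  have val: "valid_setcover I" using inp by (simp add: setcover_input_def)
  have xs: "set xs \<subseteq> {..<num_elems I}"
    using inp by (fastforce simp: setcover_input_def covered_def valid_setcover_def)
  from run obtain s0 w0 t0 u where
    s0: "big_step ?orc (init A) ((\<lambda>_. Atom)(0 := enc_paging (paging_of I))) w s0 w0 t0"
    and serve: "serve ?orc (step A) s0 w0 (map (set_page I) [0..<?m] @ xs) = Some (vs, u)"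
    and t: "t = t0 + u"
    unfolding paging_run_def run_eq_Some_iff page_requests_def by auto
  let ?\<sigma> = "(\<lambda>_. Atom)(0 := enc_setcover I)"
  from wp_setup_prog[of ?\<sigma> I] obtain \<sigma>1 t1 where
    a1: "big_step (\<lambda>_. Atom) setup_prog ?\<sigma> w \<sigma>1 w t1" and t1: "t1 \<le> 80 * width I"
    and \<sigma>1: "\<sigma>1 vPages = enc_name (num_elems I + ?m)" "\<sigma>1 base = enc_paging (paging_of I)"
    unfolding wp_def by auto
  have f1: "\<sigma>1 y = ?\<sigma> y" if "y \<notin> mods setup_prog" for y
    using big_step_frame[OF a1 that] .
  have "represents I \<sigma>1 ((\<lambda>_. Atom)(0 := enc_paging (paging_of I)))"
    using \<sigma>1 f1 by (auto simp: represents_def ctx_def)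
  from big_step_simulate[OF s0 val this] obtain \<sigma>2 t2 where
    a2: "big_step (\<lambda>_. Atom) (simulate (init A)) \<sigma>1 w \<sigma>2 w0 t2"
    and rep2: "represents I \<sigma>2 s0" and t2: "t2 \<le> 520 * W * t0"
    by (auto simp: W_def)
  have "\<sigma>2 vEvicted = \<sigma>1 vEvicted"
    by (rule big_step_frame[OF a2]) (use mods_simulate[of vEvicted "init A"] in auto)
  then have ev2: "\<sigma>2 vEvicted = Atom" using f1[of vEvicted] by simp
  note ctx2 = ctxD[OF representsD(1)[OF rep2]]
  let ?\<sigma>3 = "\<sigma>2(vNext := \<sigma>2 vPages)" and ?todo = "enc_list (map (enc_member I) [0..<?m])"
  let ?\<sigma>4 = "?\<sigma>3(vTodo := ?todo)"
  have a3: "big_step (\<lambda>_. Atom) (Assign vNext (EVar vPages)) \<sigma>2 w0 ?\<sigma>3 w0 2"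
    using big_step.Assign[of "\<lambda>_. Atom" vNext "EVar vPages" \<sigma>2 w0]
    by (simp add: numeral_2_eq_2)
  have a4: "big_step (\<lambda>_. Atom) (Assign vTodo (ETl (EVar vInst))) ?\<sigma>3 w0 ?\<sigma>4 w0 3"
    using big_step.Assign[of "\<lambda>_. Atom" vTodo "ETl (EVar vInst)" ?\<sigma>3 w0] ctx2
    by (simp add: numeral_3_eq_3)
  have rep4: "represents I ?\<sigma>4 s0" using rep2 by (auto simp: represents_def ctx_def)
  have next4: "?\<sigma>4 vNext = enc_name (num_elems I + ?m - 0)" using ctx2 by simp
  have todo4: "?\<sigma>4 vTodo = ?todo" and evicted4: "?\<sigma>4 vEvicted = Atom" using ev2 by simp_all
  from load_pages[OF val serve rep4 le0 todo4 next4, folded W_def, unfolded evicted4]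
  obtain \<sigma>5 s5 w5 vs1 vs2 u1 u2 t5 where
    a5: "big_step (\<lambda>_. Atom) (for_each vTodo (load_body A)) ?\<sigma>4 w0 \<sigma>5 w5 t5"
    and rep5: "represents I \<sigma>5 s5" and serve5: "serve ?orc (step A) s5 w5 xs = Some (vs2, u2)"
    and vs: "vs = vs1 @ vs2" "length vs1 = ?m - 0" and u: "u = u1 + u2"
    and ev5: "dec_names (\<sigma>5 vEvicted) = dec_names Atom \<union> \<Union> (dec_names ` set vs1)"
      "dec_name (\<sigma>5 vEvicted) \<le> dec_name Atom + u1"
    and t5: "t5 \<le> 2 + 600 * (W * u1)"
    by (elim exE conjE) (rule that)
  from serve_elements[OF val serve5 rep5 xs, folded W_def] obtain js u' where
    serve': "serve (\<lambda>_. Atom) (step (setcover_alg A)) \<sigma>5 w5 xs = Some (js, u')"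
    and fol: "follows I (dec_names (\<sigma>5 vEvicted)) xs (map dec_names vs2) (map dec_name js)"
    and u': "u' \<le> length xs * (1000 * (W * (1 + dec_name (\<sigma>5 vEvicted) + u2)))"
    by (elim exE conjE) (rule that)
  let ?ti = "1 + t1 + (1 + t2 + (1 + 2 + (1 + 3 + t5)))"
  have "big_step (\<lambda>_. Atom) (init (setcover_alg A)) ?\<sigma> w \<sigma>5 w5 ?ti"
    unfolding setcover_alg_def online_alg.simps
    by (rule big_step.Seq[OF a1 big_step.Seq[OF a2 big_step.Seq[OF a3 big_step.Seq[OF a4 a5]]]])
  with serve' have run': "setcover_run (setcover_alg A) I xs w = Some (js, ?ti + u')"
    unfolding setcover_run_def run_eq_Some_iff by blast
  \<comment> \<open>This unit, spent in \<open>init A\<close>, pays for the \<open>1 +\<close> in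
    the bound for serving: \<open>1 + u1 + u2 \<le> t\<close>.\<close>
  have t0: "1 \<le> t0" using s0 by (rule big_step_time_pos)
  have "?ti + u' \<le> 1000 * (W * ((1 + length xs) * t))"
  proof -
    have arith: "1 + a + (1 + b + (1 + 2 + (1 + 3 + c))) + d \<le> 1000 * ((1 + l) * X)"
      if "a \<le> 80 * X" "b + c \<le> 2 + 600 * X" "11 \<le> 11 * X" "d \<le> l * (1000 * X)"
      for a b c d l X :: nat
      using that by (simp add: algebra_simps)
    have "width I ^ 1 \<le> W" unfolding W_def by (rule power_increasing) (auto simp: width_def)
    moreover have Wt: "W \<le> W * t" using t0 t by simp
    ultimately have "width I \<le> W * t" unfolding power_one_right by (rule order_trans)
    from order_trans[OF t1 mult_le_mono2[OF this]] have "t1 \<le> 80 * (W * t)" .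
    moreover have "t2 + t5 \<le> 2 + 600 * (W * t)"
      using t2 t5 by (simp add: t u distrib_left)
    moreover have "11 \<le> 11 * (W * t)" using Wt W by simp
    moreover have "u' \<le> length xs * (1000 * (W * t))"
      by (rule order_trans[OF u'], intro mult_le_mono2) (use t0 ev5(2) t u in simp)
    ultimately have "?ti + u' \<le> 1000 * ((1 + length xs) * (W * t))" by (rule arith)
    then show ?thesis by (simp only: mult.left_commute[of W])
  qed
  also have "\<dots> \<le> 1000 * ((setcover_size I xs + 1) ^ 4 * ((setcover_size I xs + 1) * t))"
  proof (intro mult_le_mono mult_le_mono2)
    have "num_sets I \<le> (\<Sum>j<num_sets I. 1 + card (set_of I j) + rat_length (set_cost I j))"
      unfolding sum.distrib by simp
    then have "width I \<le> setcover_size I xs + 1" by (simp add: width_def setcover_size_def)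
    then show "W \<le> (setcover_size I xs + 1) ^ 4" unfolding W_def by (rule power_mono) simp
  qed (simp_all add: setcover_size_def)
  also have "\<dots> = 1000 * (setcover_size I xs + 1) ^ 5 * t"
    using power_add[of "setcover_size I xs + 1" 4 1] by (simp add: algebra_simps)
  finally have "?ti + u' \<le> 1000 * (setcover_size I xs + 1) ^ 5 * t" .
  moreover have "follows I (\<Union> (dec_names ` set vs1)) xs (map dec_names vs2) (map dec_name js)"
    using fol ev5(1) by simp
  moreover have "length vs1 = ?m" using vs(2) by simp
  ultimately show ?thesis using run' vs(1) by blast
qed

text \<open>Running times need not be shown to be measurable: this inequality holds for all functions.\<close>

lemma nn_integral_cmult_le:
  fixes c :: ennreal
  assumes c: "c \<noteq> 0" "c \<noteq> top"
  shows "(\<integral>\<^sup>+ x. c * f x \<partial>M) \<le> c * (\<integral>\<^sup>+ x. f x \<partial>M)"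
  unfolding nn_integral_def[of M "\<lambda>x. c * f x"]
proof (rule SUP_least)
  fix g assume "g \<in> {g. simple_function M g \<and> g \<le> (\<lambda>x. c * f x)}"
  then have g: "simple_function M g" "\<And>x. g x \<le> c * f x" by (auto simp: le_fun_def)
  let ?h = "\<lambda>x. g x / c"
  have h: "simple_function M ?h" using g(1) by (rule simple_function_compose1)
  have "g x / c \<le> f x" for x
    using divide_right_mono_ennreal[OF g(2)[of x], of c] mult_divide_eq_ennreal[OF c, of "f x"]
    by (simp only: mult.commute)
  then have le: "integral\<^sup>S M ?h \<le> (\<integral>\<^sup>+ x. f x \<partial>M)"
    unfolding nn_integral_def by (intro SUP_upper) (auto simp: h le_fun_def)
  have "c * (g x / c) = g x" for x
    using mult_divide_eq_ennreal[OF c, of "g x"] by (simp only: ennreal_times_divide mult.commute)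
  then have "integral\<^sup>S M g = integral\<^sup>S M (\<lambda>x. c * ?h x)" by simp
  also have "\<dots> = c * integral\<^sup>S M ?h" using h by (rule simple_integral_mult)
  also have "\<dots> \<le> c * (\<integral>\<^sup>+ x. f x \<partial>M)" using le by (rule mult_left_mono) simp
  finally show "integral\<^sup>S M g \<le> c * (\<integral>\<^sup>+ x. f x \<partial>M)" .
qed

section \<open>Running time and competitiveness\<close>

lemma run_time_le:
  assumes inp: "setcover_input I xs" and size: "setcover_size I xs \<le> n"
  shows "run_time (setcover_run (setcover_alg A) I xs w) \<le>
    enat (1000 * (n + 1) ^ 5) * run_time (paging_run A (paging_of I) (page_requests I @ xs) w)"
proof (cases "paging_run A (paging_of I) (page_requests I @ xs) w")
  case None
  \<comment> \<open>In \<open>enat\<close>, \<open>0 * \<infinity> = 0\<close>; a diverging paging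
    run gives an infinite bound because the factor is nonzero.\<close>
  have "enat (1000 * (n + 1) ^ 5) \<noteq> 0" by (simp add: zero_enat_def)
  then have "enat (1000 * (n + 1) ^ 5) * \<infinity> = \<infinity>" by (simp add: imult_is_infinity)
  then show ?thesis using None by (simp add: run_time_def)
next
  case (Some r)
  then obtain vs t where run: "paging_run A (paging_of I) (page_requests I @ xs) w = Some (vs, t)"
    by (cases r) auto
  from setcover_run_simulates[OF inp run] obtain js t' where
    "setcover_run (setcover_alg A) I xs w = Some (js, t')"
    "t' \<le> 1000 * (setcover_size I xs + 1) ^ 5 * t" by blast
  moreover have "1000 * (setcover_size I xs + 1) ^ 5 * t \<le> 1000 * (n + 1) ^ 5 * t"
    by (intro mult_le_mono mult_le_mono2 power_mono) (use size in auto)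
  ultimately have "setcover_run (setcover_alg A) I xs w = Some (js, t')"
    "t' \<le> 1000 * (n + 1) ^ 5 * t" by (blast intro: order_trans)+
  then show ?thesis using run by (simp add: run_time_def)
qed

theorem theorem1p7:
  fixes \<rho> :: "nat \<Rightarrow> real" and A :: online_alg
  assumes "\<And>N. \<rho> N \<ge> 1"
    and "competitive_paging \<rho> A"
  shows "\<exists>B. oracle_free B \<and> (deterministic A \<longrightarrow> deterministic B) \<and>
    competitive_setcover (\<lambda>n m. \<rho> (n + m)) B \<and>
    (\<exists>(q :: nat poly) (a :: nat). \<forall>n.
       setcover_worst_time B n \<le> enat (poly q n) * paging_worst_time A (a * n) \<and>
       setcover_expected_time B n \<le> of_nat (poly q n) * paging_expected_time A (a * n))"
proof (intro exI[of _ "setcover_alg A"] conjI impI)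
  let ?B = "setcover_alg A"
  show "oracle_free ?B"
    by (simp add: oracle_free_def setcover_alg_def load_body_def)
  show "deterministic ?B" if "deterministic A"
    using that by (simp add: deterministic_def setcover_alg_def load_body_def)
  show "competitive_setcover (\<lambda>n m. \<rho> (n + m)) ?B"
    unfolding competitive_setcover_def
  proof (intro allI impI)
    fix I xs assume inp: "setcover_input I xs"
    let ?J = "paging_of I" and ?ps = "page_requests I @ xs"
    let ?f = "\<lambda>w. case setcover_run ?B I xs w of None \<Rightarrow> \<infinity>
      | Some (vs, t) \<Rightarrow>
          ennreal (real_of_rat (cover_cost I (chosen I {} xs (map dec_name vs))))"
    let ?g = "\<lambda>w. case paging_run A ?J ?ps w of None \<Rightarrow> \<infinity>
      | Some (vs, t) \<Rightarrow> ennreal (real_of_rat (eviction_cost ?J (map dec_names vs)))"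
    from assms(2) paging_input_of[OF inp]
    have ae: "AE w in coins. \<exists>vs t. paging_run A ?J ?ps w = Some (vs, t) \<and>
          schedule ?J {} ?ps (map dec_names vs)"
      and le: "(\<integral>\<^sup>+ w. ?g w \<partial>coins) \<le> ennreal (\<rho> (num_pages ?J)) * paging_opt ?J ?ps"
      unfolding competitive_paging_def by auto
    \<comment> \<open>Correctness and the comparison of costs hold for every single toss sequence on
      which the paging run succeeds, so the almost sure claim and the bound on the expectation are
      inherited.\<close>
    have good: "(\<exists>vs t. setcover_run ?B I xs w = Some (vs, t) \<and>
        choices_ok I {} xs (map dec_name vs)) \<and> ?f w \<le> ?g w"
      if "\<exists>vs t. paging_run A ?J ?ps w = Some (vs, t) \<and> schedule ?J {} ?ps (map dec_names vs)" for w
    proof -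
      from that obtain vs t where run: "paging_run A ?J ?ps w = Some (vs, t)"
        and sched: "schedule ?J {} ?ps (map dec_names vs)" by blast
      from setcover_run_simulates[OF inp run] obtain js t' vs1 vs2 where
        js: "setcover_run ?B I xs w = Some (js, t')" and vs: "vs = vs1 @ vs2"
        and "length vs1 = num_sets I"
        and "follows I (\<Union> (dec_names ` set vs1)) xs (map dec_names vs2) (map dec_name js)"
        by blast
      from follows_competitive[OF inp sched[unfolded vs] this(3,4)] js run vs
      show ?thesis by (auto simp: of_rat_less_eq intro!: ennreal_leI)
    qed
    have "AE w in coins. \<exists>vs t. setcover_run ?B I xs w = Some (vs, t) \<and>
        choices_ok I {} xs (map dec_name vs)"
      using ae by eventually_elim (use good in blast)
    moreover have "(\<integral>\<^sup>+ w. ?f w \<partial>coins) \<le> (\<integral>\<^sup>+ w. ?g w \<partial>coins)"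
      by (rule nn_integral_mono_AE) (use ae in eventually_elim, use good in blast)
    moreover have "ennreal (\<rho> (num_pages ?J)) * paging_opt ?J ?ps \<le>
        ennreal (\<rho> (num_elems I + num_sets I)) * setcover_opt I xs"
      using paging_opt_le[OF inp] by (simp add: paging_of_def mult_left_mono)
    ultimately show "(AE w in coins. \<exists>vs t. setcover_run ?B I xs w = Some (vs, t) \<and>
          choices_ok I {} xs (map dec_name vs)) \<and>
        (\<integral>\<^sup>+ w. ?f w \<partial>coins) \<le> ennreal (\<rho> (num_elems I + num_sets I)) * setcover_opt I xs"
      using le by (meson order_trans)
  qed
  \<comment> \<open>The polynomial is the factor of \<open>setcover_run_simulates\<close>; the
    scaling 6 of the input size comes from \<open>paging_size_of\<close>.\<close>
  let ?q = "smult 1000 ([:1, 1:] ^ 5) :: nat poly"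
  have q: "poly ?q n = 1000 * (n + 1) ^ 5" for n by (simp add: poly_power)
  have in_range: "(paging_of I, page_requests I @ xs) \<in>
      {(J, ps). paging_input J ps \<and> paging_size J ps \<le> 6 * n}"
    if "setcover_input I xs" "setcover_size I xs \<le> n" for I xs n
    using paging_input_of[OF that(1)] paging_size_of[of I xs] that
    by (simp add: setcover_input_def)
  show "\<exists>(q :: nat poly) (a :: nat). \<forall>n.
       setcover_worst_time ?B n \<le> enat (poly q n) * paging_worst_time A (a * n) \<and>
       setcover_expected_time ?B n \<le> of_nat (poly q n) * paging_expected_time A (a * n)"
  proof (intro exI[of _ ?q] exI[of _ 6] allI conjI)
    fix n
    show "setcover_worst_time ?B n \<le> enat (poly ?q n) * paging_worst_time A (6 * n)"
      unfolding setcover_worst_time_def q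
    proof (rule SUP_least, clarify, rule SUP_least)
      fix I xs w assume *: "setcover_input I xs" "setcover_size I xs \<le> n"
      have "run_time (paging_run A (paging_of I) (page_requests I @ xs) w) \<le>
          paging_worst_time A (6 * n)"
        unfolding paging_worst_time_def
        by (rule SUP_upper2[OF in_range[OF *]]) (auto intro: SUP_upper)
      then show "run_time (setcover_run ?B I xs w) \<le>
          enat (1000 * (n + 1) ^ 5) * paging_worst_time A (6 * n)"
        by (intro order_trans[OF run_time_le[OF *]] mult_left_mono) auto
    qed
    show "setcover_expected_time ?B n \<le> of_nat (poly ?q n) * paging_expected_time A (6 * n)"
      unfolding setcover_expected_time_def q
    proof (rule SUP_least, clarify)
      fix I xs assume *: "setcover_input I xs" "setcover_size I xs \<le> n"
      let ?c = "of_nat (1000 * (n + 1) ^ 5) :: ennreal"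
      let ?T = "\<lambda>w. run_time (paging_run A (paging_of I) (page_requests I @ xs) w)"
      have mult: "ennreal_of_enat (enat k * r) = of_nat k * ennreal_of_enat r" if "k \<noteq> 0" for k r
        using that
        by (cases r) (auto simp: ennreal_mult_top enat_0_iff imult_is_infinity ennreal_of_enat_def)
      have "(\<integral>\<^sup>+ w. ennreal_of_enat (run_time (setcover_run ?B I xs w)) \<partial>coins) \<le>
          (\<integral>\<^sup>+ w. ?c * ennreal_of_enat (?T w) \<partial>coins)"
      proof (rule nn_integral_mono)
        fix w
        have "ennreal_of_enat (run_time (setcover_run ?B I xs w)) \<le>
            ennreal_of_enat (enat (1000 * (n + 1) ^ 5) * ?T w)"
          using run_time_le[OF *] by (simp only: ennreal_of_enat_le_iff)
        then show "ennreal_of_enat (run_time (setcover_run ?B I xs w)) \<le>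
            ?c * ennreal_of_enat (?T w)"
          by (subst (asm) mult) auto
      qed
      also have "\<dots> \<le> ?c * (\<integral>\<^sup>+ w. ennreal_of_enat (?T w) \<partial>coins)"
        by (rule nn_integral_cmult_le) (simp_all only: of_nat_eq_0_iff less_imp_neq[OF of_nat_less_top], auto)
      also have "\<dots> \<le> ?c * paging_expected_time A (6 * n)"
        unfolding paging_expected_time_def
        by (intro mult_left_mono SUP_upper2[OF in_range[OF *]]) auto
      finally show "(\<integral>\<^sup>+ w. ennreal_of_enat (run_time (setcover_run ?B I xs w)) \<partial>coins) \<le>
          ?c * paging_expected_time A (6 * n)" .
    qed
  qed
qed

end
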